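(* Let $\mathcal{X}$ be the data domain, a measurable space with at least two points in which singletons are measurable, and let $\mathcal{P}$ be the set of all probability distributions on $\mathcal{X}$. (a) Let $\mu\ge 0$. If a mechanism $M$ satisfies $\mu$-CI-LMIP, then for every $\epsilon>0$ it satisfies $(\epsilon,\delta^{\mathrm{LDP}}_\mu(\epsilon))$-LDP, where $$\delta^{\mathrm{LDP}}_\mu(\epsilon)=\max_{\substack{p_0,p_1\in[0,1]\\ C_{\mathrm{BAC}}(p_0,1-p_1)\le \mu}}\ \max\{0,\ p_0-e^{\epsilon}p_1,\ p_1-e^{\epsilon}p_0\}$$ and $C_{\mathrm{BAC}}(\epsilon_0,\epsilon_1)$ is the capacity (in bits) of the binary asymmetric channel with crossover probabilities $(\epsilon_0,\epsilon_1)$. Specifically, if $0\le\epsilon_0\le\min\{\epsilon_1,1-\epsilon_1,1/2\}$ and $\epsilon_0+\epsilon_1\neq 1$, then $$C_{\mathrm{BAC}}(\epsilon_0,\epsilon_1)=\frac{\epsilon_0}{1-\epsilon_0-\epsilon_1}H_{\mathrm b}(\epsilon_1)-\frac{1-\epsilon_1}{1-\epsilon_0-\epsilon_1}H_{\mathrm b}(\epsilon_0)+\log\Big(1+2^{\frac{H_{\mathrm b}(\epsilon_0)-H_{\mathrm b}(\epsilon_1)}{1-\epsilon_0-\epsilon_1}}\Big),$$ while $C_{\mathrm{BAC}}(\epsilon_0,\epsilon_1)=0$ if $\epsilon_0+\epsilon_1=1$; otherwise $C_{\mathrm{BAC}}(\epsilon_0,\epsilon_1)$ equals $C_{\mathrm{BAC}}(\epsilon_1,\epsilon_0)$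 if $\epsilon_0>\epsilon_1$, equals $C_{\mathrm{BAC}}(1-\epsilon_1,1-\epsilon_0)$ if $\epsilon_0>1-\epsilon_1$, and equals $C_{\mathrm{BAC}}(1-\epsilon_0,1-\epsilon_1)$ if $\epsilon_0>1/2$. Moreover, a mechanism satisfying $\mu$-CI-LMIP need not satisfy $(\epsilon,\delta)$-LDP for $\delta<\delta^{\mathrm{LDP}}_\mu(\epsilon)$: for every $\epsilon>0$ there exists a mechanism that satisfies $\mu$-CI-LMIP but does not satisfy $(\epsilon,\delta)$-LDP for any $\delta<\delta^{\mathrm{LDP}}_\mu(\epsilon)$. (b) Let $\delta:(0,\infty)\to[0,1]$ be a measurable function. If a mechanism $M$ satisfies $(\epsilon,\delta(\epsilon))$-LDP for every $\epsilon>0$, then it satisfies $\mu^{\mathrm{CI}}_{\delta(\epsilon)}$-CI-LMIP with $$\mu^{\mathrm{CI}}_{\delta(\epsilon)}=\log(e)\int_0^\infty(1+e^{-\epsilon})\,\delta(\epsilon)\,\mathrm{d}\epsilon\quad\text{bits}.$$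
   Context: $\log$ is the base-2 logarithm; mutual information $I(\cdot;\cdot)$ is in bits. A (randomized) mechanism $M$ on $\mathcal{X}$ is a Markov kernel from $\mathcal{X}$ to some measurable output space: for $x\in\mathcal{X}$, $M(x)$ denotes the random output on input $x$; for a random input $X\sim P_X$, $M(X)$ denotes the output whose conditional law given $X=x$ is the law of $M(x)$. CI-LMIP (context-independent local mutual-information privacy): $M$ satisfies $\mu$-CI-LMIP (with respect to a data distribution space $\mathcal{P}$) if and only if $\sup_{P_X\in\mathcal{P}} I(X;M(X))\le\mu$ bits. LDP (local differential privacy): $M$ satisfies $(\epsilon,\delta)$-LDP if and only if for every pair of data points $x,x'\in\mathcal{X}$ and every measurable set $\mathcal{E}$ of outputs, $\mathbb{P}[M(x)\in\mathcal{E}]\le e^{\epsilon}\,\mathbb{P}[M(x')\in\mathcal{E}]+\delta$. The binary asymmetric channel with crossover probabilities $(\epsilon_0,\epsilon_1)\in[0,1]^2$ has input $A\in\{0,1\}$ and output $B\in\{0,1\}$ with $\mathbb{P}[B=1\mid A=0]=\epsilon_0$ and $\mathbb{P}[B=0\mid A=1]=\epsilon_1$; its capacity is $\sup_{P_A} I(A;B)$. The binary entropy is $H_{\mathrm b}(p)=-p\log p-(1-p)\log(1-p)$, with $0\log 0=0$. *)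

theory Defs
  imports "HOL-Probability.Probability"
begin

definition mechanism :: "'a measure \<Rightarrow> 'b measure \<Rightarrow> ('a \<Rightarrow> 'b measure) \<Rightarrow> bool" where
  "mechanism X Y M \<longleftrightarrow> M \<in> X \<rightarrow>\<^sub>M prob_algebra Y"

abbreviation distributions :: "'a measure \<Rightarrow> 'a measure set" where
  "distributions X \<equiv> space (prob_algebra X)"

text \<open>The joint law of \<open>(X, M(X))\<close> when \<open>X\<close> has law \<open>P\<close>.\<close>
definition joint_law ::
  "'a measure \<Rightarrow> 'b measure \<Rightarrow> 'a measure \<Rightarrow> ('a \<Rightarrow> 'b measure) \<Rightarrow> ('a \<times> 'b) measure" where
  "joint_law X Y P M = P \<bind> (\<lambda>x. M x \<bind> (\<lambda>y. return (X \<Otimes>\<^sub>M Y) (x, y)))"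

text \<open>
  \<^const>\<open>prob_space.mutual_information\<close> is real-valued and unspecified or zero when the
  Kullback--Leibler divergence is infinite, that is, when the joint law is not absolutely
  continuous with respect to the product of the marginals, or when the logarithm of the density
  is not integrable (its negative part always is). These are the cases with value \<open>\<infinity>\<close>.
\<close>
definition mutual_information_bits ::
  "'o measure \<Rightarrow> 'a measure \<Rightarrow> 'b measure \<Rightarrow> ('o \<Rightarrow> 'a) \<Rightarrow> ('o \<Rightarrow> 'b) \<Rightarrow> ereal" where
  "mutual_information_bits \<Omega> S T U V =
     (let joint = distr \<Omega> (S \<Otimes>\<^sub>M T) (\<lambda>\<omega>. (U \<omega>, V \<omega>));
          indep = distr \<Omega> S U \<Otimes>\<^sub>M distr \<Omega> T V
      in if absolutely_continuous indep joint \<and> integrable joint (entropy_density 2 indep joint)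
         then ereal (prob_space.mutual_information \<Omega> 2 S T U V) else \<infinity>)"

definition channel_information ::
  "'a measure \<Rightarrow> 'b measure \<Rightarrow> 'a measure \<Rightarrow> ('a \<Rightarrow> 'b measure) \<Rightarrow> ereal" where
  "channel_information X Y P M = mutual_information_bits (joint_law X Y P M) X Y fst snd"

definition CI_LMIP ::
  "'a measure \<Rightarrow> 'b measure \<Rightarrow> 'a measure set \<Rightarrow> ereal \<Rightarrow> ('a \<Rightarrow> 'b measure) \<Rightarrow> bool" where
  "CI_LMIP X Y \<P> \<mu> M \<longleftrightarrow> (SUP P\<in>\<P>. channel_information X Y P M) \<le> \<mu>"

definition LDP ::
  "'a measure \<Rightarrow> 'b measure \<Rightarrow> real \<Rightarrow> real \<Rightarrow> ('a \<Rightarrow> 'b measure) \<Rightarrow> bool" where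
  "LDP X Y \<epsilon> \<delta> M \<longleftrightarrow>
     (\<forall>x\<in>space X. \<forall>x'\<in>space X. \<forall>E\<in>sets Y. measure (M x) E \<le> exp \<epsilon> * measure (M x') E + \<delta>)"

text \<open>
  The letter \<open>1\<close> is \<^const>\<open>True\<close> and \<open>0\<close> is \<^const>\<open>False\<close>. The crossover probabilities are meant
  to lie in \<open>[0,1]\<close>: outside, \<^const>\<open>bernoulli_pmf\<close> clips its parameter.
\<close>
definition bac :: "real \<Rightarrow> real \<Rightarrow> bool \<Rightarrow> bool measure" where
  "bac \<epsilon>\<^sub>0 \<epsilon>\<^sub>1 a = measure_pmf (bernoulli_pmf (if a then 1 - \<epsilon>\<^sub>1 else \<epsilon>\<^sub>0))"

definition C_BAC :: "real \<Rightarrow> real \<Rightarrow> ereal" where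
  "C_BAC \<epsilon>\<^sub>0 \<epsilon>\<^sub>1 =
     (SUP P\<in>distributions (count_space UNIV).
        channel_information (count_space UNIV) (count_space UNIV) P (bac \<epsilon>\<^sub>0 \<epsilon>\<^sub>1))"

definition binary_entropy :: "real \<Rightarrow> real" where
  "binary_entropy p = - p * log 2 p - (1 - p) * log 2 (1 - p)"

definition delta_LDP_values :: "real \<Rightarrow> real \<Rightarrow> real set" where
  "delta_LDP_values \<mu> \<epsilon> =
     {Max {0, p\<^sub>0 - exp \<epsilon> * p\<^sub>1, p\<^sub>1 - exp \<epsilon> * p\<^sub>0} | p\<^sub>0 p\<^sub>1.
        p\<^sub>0 \<in> {0..1} \<and> p\<^sub>1 \<in> {0..1} \<and> C_BAC p\<^sub>0 (1 - p\<^sub>1) \<le> ereal \<mu>}"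

text \<open>
  A supremum because \<^const>\<open>Max\<close> is only for finite sets. That it is a maximum is the claim
  \<open>delta_LDP \<mu> \<epsilon> \<in> delta_LDP_values \<mu> \<epsilon>\<close>.
\<close>
definition delta_LDP :: "real \<Rightarrow> real \<Rightarrow> real" where
  "delta_LDP \<mu> \<epsilon> = Sup (delta_LDP_values \<mu> \<epsilon>)"

text \<open>Extended-valued, since the integral may diverge.\<close>
definition mu_CI :: "(real \<Rightarrow> real) \<Rightarrow> ereal" where
  "mu_CI \<delta> =
     ereal (log 2 (exp 1)) *
     enn2ereal (\<integral>\<^sup>+\<epsilon>\<in>{0<..}. ennreal ((1 + exp (- \<epsilon>)) * \<delta> \<epsilon>) \<partial>lborel)"

end

theory Submission
  imports Defs
begin

text \<open>
  Write \<open>Q\<close> for the product of the marginals and \<open>N\<close> for the joint law of \<open>(X, M(X))\<close>, so that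
  the mutual information is the divergence of \<open>N\<close> from \<open>Q\<close>.

  Part (a): restricting the input to two points and thresholding the output at an event turns the
  mechanism into a binary channel, whose capacity is at most \<open>\<mu>\<close> by data processing; conversely,
  a mechanism that only looks at whether its input is one distinguished point, and then emits a
  Bernoulli bit, leaks no more than the corresponding binary channel. The maximum in
  \<open>delta_LDP\<close> is attained because the capacity is a supremum of functions that are continuous in
  \<open>(p\<^sub>0, p\<^sub>1)\<close>, so that its sublevel sets are compact. For the closed form, with \<open>s\<close> the slope of
  the binary entropy between \<open>p\<^sub>0\<close> and \<open>p\<^sub>1\<close>, the capacity maximizes \<open>H\<^sub>b(q) - s q\<close> over output laws
  \<open>q\<close>; Gibbs' inequality identifies the maximizer as \<open>r = 2\<^sup>-\<^sup>s / (1 + 2\<^sup>-\<^sup>s)\<close>.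

  Part (b): with \<open>f = dN/dQ\<close>, the relative entropy is the \<open>Q\<close>-integral of \<open>f ln f - f + 1\<close>, and
  this function is the integral over \<open>t > 0\<close> of \<open>(f - e\<^sup>t)\<^sup>+ + e\<^sup>-\<^sup>t (1 - e\<^sup>t f)\<^sup>+\<close>. By Tonelli it remains
  to note that LDP, averaged over inputs, bounds the \<open>Q\<close>-integrals of both positive parts by \<open>\<delta>(t)\<close>.
\<close>

subsection \<open>Kullback--Leibler divergence in bits\<close>

text \<open>The case distinction of \<open>mutual_information_bits\<close>, separated from random
  variables so that density formulas and data processing can be stated for two arbitrary measures.
  The reference measure comes first, as in \<open>KL_divergence\<close>.\<close>

definition kl_bits :: "'a measure \<Rightarrow> 'a measure \<Rightarrow> ereal" where
  "kl_bits Q N =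
     (if absolutely_continuous Q N \<and> integrable N (entropy_density 2 Q N)
      then ereal (KL_divergence 2 Q N) else \<infinity>)"

text \<open>A density is absolutely continuous by construction, so only integrability decides
  finiteness. \<open>RN_deriv\<close> is unique almost everywhere, so \<open>f\<close> may replace
  it; its factor moves the integral from \<open>density Q f\<close> to \<open>Q\<close>.\<close>

lemma kl_bits_density:
  fixes f :: "'a \<Rightarrow> real"
  assumes "prob_space Q" and f[measurable]: "f \<in> borel_measurable Q" and nn: "\<And>x. 0 \<le> f x"
  shows "kl_bits Q (density Q f) =
    (if integrable Q (\<lambda>x. f x * log 2 (f x)) then ereal (\<integral>x. f x * log 2 (f x) \<partial>Q) else \<infinity>)"
proof -
  interpret prob_space Q by fact
  have ac: "absolutely_continuous Q (density Q f)"
    by (rule absolutely_continuousI_density) simp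
  have "AE x in Q. ennreal (f x) = RN_deriv Q (density Q f) x"
    by (rule RN_deriv_unique) auto
  then have eq: "AE x in Q. f x * entropy_density 2 Q (density Q f) x = f x * log 2 (f x)"
    by eventually_elim (metis comp_apply enn2real_ennreal entropy_density_def nn)
  have "integrable (density Q f) (entropy_density 2 Q (density Q f)) \<longleftrightarrow>
      integrable Q (\<lambda>x. f x * entropy_density 2 Q (density Q f) x)"
    by (subst integrable_real_density) (auto simp: nn)
  also have "\<dots> \<longleftrightarrow> integrable Q (\<lambda>x. f x * log 2 (f x))"
    by (rule integrable_cong_AE) (use eq in auto)
  finally show ?thesis
    using ac by (simp add: kl_bits_def KL_density nn)
qed

lemma real_density_exists:
  assumes "prob_space Q" "prob_space N" and ac: "absolutely_continuous Q N" "sets N = sets Q"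
  obtains F :: "'a \<Rightarrow> real" where "F \<in> borel_measurable Q" "\<And>x. 0 \<le> F x" "N = density Q F"
proof -
  interpret Q: prob_space Q by fact
  interpret N: prob_space N by fact
  obtain D where D: "D \<in> borel_measurable Q" "AE x in Q. RN_deriv Q N x = ennreal (D x)"
      "\<And>x. 0 \<le> D x"
    by (rule Q.real_RN_deriv[OF N.finite_measure_axioms ac]) (rule that)
  have "N = density Q (RN_deriv Q N)"
    using Q.density_RN_deriv[OF ac] by simp
  also have "\<dots> = density Q D"
    using D by (auto intro!: density_cong)
  finally show ?thesis by (rule that[OF D(1,3)])
qed

text \<open>Data processing for a deterministic map. With \<open>F\<close> the density of
  \<open>N\<close> and \<open>r\<close> that of its image, the two divergences differ by the
  divergence of \<open>N\<close> from \<open>density Q (\<lambda>x. r (g x))\<close>, which is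
  nonnegative. Finiteness of both makes the difference split into two convergent integrals.\<close>

lemma kl_bits_distr_le:
  fixes Q N :: "'a measure" and T :: "'b measure"
  assumes Q: "prob_space Q" and N: "prob_space N" and sets[measurable_cong]: "sets N = sets Q"
    and g[measurable]: "g \<in> Q \<rightarrow>\<^sub>M T"
    and fin: "kl_bits (distr Q T g) (distr N T g) \<noteq> \<infinity>"
  shows "kl_bits (distr Q T g) (distr N T g) \<le> kl_bits Q N"
proof (cases "kl_bits Q N = \<infinity>")
  case False
  interpret Q: prob_space Q by fact
  have gN[measurable]: "g \<in> N \<rightarrow>\<^sub>M T" by simp
  have acQ: "absolutely_continuous Q N" and acd: "absolutely_continuous (distr Q T g) (distr N T g)"
    using False fin by (auto simp: kl_bits_def split: if_splits)
  have dQ: "prob_space (distr Q T g)" and dN: "prob_space (distr N T g)"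
    using Q.prob_space_distr[OF g] prob_space.prob_space_distr[OF N gN] by auto
  obtain F :: "'a \<Rightarrow> real" where F[measurable]: "F \<in> borel_measurable Q" and F0: "\<And>x. 0 \<le> F x"
    and NF: "N = density Q F"
    by (rule real_density_exists[OF Q N acQ sets]) (rule that)
  obtain r :: "'b \<Rightarrow> real" where "r \<in> borel_measurable (distr Q T g)" and r0: "\<And>x. 0 \<le> r x"
    and Nr: "distr N T g = density (distr Q T g) r"
    by (rule real_density_exists[OF dQ dN acd]) (auto intro: that)
  then have r[measurable]: "r \<in> borel_measurable T" by simp
  have intF: "integrable Q (\<lambda>x. F x * log 2 (F x))"
    and klF: "kl_bits Q N = ereal (\<integral>x. F x * log 2 (F x) \<partial>Q)"
    using False unfolding NF kl_bits_density[OF Q F F0] by (auto split: if_splits)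
  have int_r: "integrable (distr Q T g) (\<lambda>x. r x * log 2 (r x))"
    and klr: "kl_bits (distr Q T g) (distr N T g) = ereal (\<integral>x. r x * log 2 (r x) \<partial>distr Q T g)"
    using fin kl_bits_density[OF dQ, of r] r0 unfolding Nr by (auto split: if_splits)
  have "integrable (distr N T g) (\<lambda>x. log 2 (r x))"
    unfolding Nr using int_r by (subst integrable_real_density) (auto simp: r0)
  then have "integrable N (\<lambda>x. log 2 (r (g x)))"
    by (subst (asm) integrable_distr_eq) auto
  then have intFr: "integrable Q (\<lambda>x. F x * log 2 (r (g x)))"
    unfolding NF by (subst (asm) integrable_real_density) (auto simp: F0)
  have "(\<integral>x. r x * log 2 (r x) \<partial>distr Q T g) = (\<integral>x. log 2 (r x) \<partial>distr N T g)"
    unfolding Nr by (subst integral_real_density) (auto simp: r0)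
  also have "\<dots> = (\<integral>x. log 2 (r (g x)) \<partial>N)"
    by (rule integral_distr) auto
  also have "\<dots> = (\<integral>x. F x * log 2 (r (g x)) \<partial>Q)"
    unfolding NF by (subst integral_real_density) (auto simp: F0)
  finally have klr': "kl_bits (distr Q T g) (distr N T g) = ereal (\<integral>x. F x * log 2 (r (g x)) \<partial>Q)"
    using klr by simp

  \<comment> \<open>The comparison measure is \<open>Q\<close> reweighted so that its image under
    \<open>g\<close> is the image of \<open>N\<close>.\<close>
  have R: "prob_space (density Q (\<lambda>x. r (g x)))"
  proof
    have "emeasure (density Q (\<lambda>x. r (g x))) (space Q) = emeasure (density (distr Q T g) r) (space T)"
      by (simp add: emeasure_density nn_integral_distr cong: nn_integral_cong_simp)
    also have "\<dots> = 1"
      using prob_space.emeasure_space_1[OF dN] Nr by simp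
    finally show "emeasure (density Q (\<lambda>x. r (g x))) (space (density Q (\<lambda>x. r (g x)))) = 1" by simp
  qed
  \<comment> \<open>A density is nonzero almost everywhere for the measure it defines. Hence
    \<open>F\<close> vanishes where \<open>r (g x)\<close> does, so the logarithm of the quotient
    can be split.\<close>
  have "AE y in distr N T g. r y \<noteq> 0"
    unfolding Nr by (subst AE_density) (auto simp: r0)
  then have "AE x in N. r (g x) \<noteq> 0"
    by (subst (asm) AE_distr_iff) auto
  then have ac: "AE x in Q. r (g x) = 0 \<longrightarrow> F x = 0"
    unfolding NF by (subst (asm) AE_density) (auto elim!: eventually_mono simp: F0 less_le)
  then have eq: "AE x in Q. F x * log 2 (F x / r (g x)) = F x * log 2 (F x) - F x * log 2 (r (g x))"
    by eventually_elim (use F0 r0 in \<open>auto simp: log_divide right_diff_distrib less_le\<close>)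
  have int: "integrable Q (\<lambda>x. F x * log 2 (F x / r (g x)))"
    by (subst integrable_cong_AE[OF _ _ eq]) (use intF intFr in auto)
  have "0 \<le> KL_divergence 2 (density Q (\<lambda>x. r (g x))) (density Q F)"
    by (rule Q.KL_density_density_nonneg) (use R ac int F0 r0 N NF in auto)
  also have "\<dots> = (\<integral>x. F x * log 2 (F x / r (g x)) \<partial>Q)"
    by (rule Q.KL_density_density) (use ac F0 r0 in auto)
  also have "\<dots> = (\<integral>x. F x * log 2 (F x) \<partial>Q) - (\<integral>x. F x * log 2 (r (g x)) \<partial>Q)"
    by (subst integral_cong_AE[OF _ _ eq]) (use intF intFr in auto)
  finally show ?thesis using klF klr' by simp
qed simp

subsection \<open>Joint law of input and output\<close>

lemma distributionsD:
  assumes "P \<in> distributions X"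
  shows "prob_space P" "sets P = sets X" "space P = space X"
  using assms by (auto simp: space_prob_algebra dest: sets_eq_imp_space_eq)

lemma mechanismD:
  assumes M: "mechanism X Y M" and x: "x \<in> space X"
  shows "prob_space (M x)" "sets (M x) = sets Y" "space (M x) = space Y"
proof -
  have "M x \<in> space (prob_algebra Y)"
    using M x unfolding mechanism_def by (rule measurable_space)
  then show "prob_space (M x)" "sets (M x) = sets Y" "space (M x) = space Y"
    by (auto simp: space_prob_algebra dest: sets_eq_imp_space_eq)
qed

context
  fixes X :: "'a measure" and Y :: "'b measure" and P M
  assumes P: "P \<in> distributions X" and M: "mechanism X Y M"
begin

lemma measurable_mechanism: "M \<in> P \<rightarrow>\<^sub>M prob_algebra Y"
  using M distributionsD[OF P] unfolding mechanism_def by (simp cong: measurable_cong_sets)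

lemma measurable_joint_kernel:
  "(\<lambda>x. M x \<bind> (\<lambda>y. return (X \<Otimes>\<^sub>M Y) (x, y))) \<in> P \<rightarrow>\<^sub>M prob_algebra (X \<Otimes>\<^sub>M Y)"
proof -
  have [measurable_cong]: "sets P = sets X" using distributionsD[OF P] by simp
  note [measurable] = measurable_mechanism
  show ?thesis by measurable
qed

lemma joint_law_in: "joint_law X Y P M \<in> space (prob_algebra (X \<Otimes>\<^sub>M Y))"
proof -
  have PP: "P \<in> space (prob_algebra P)" using distributionsD[OF P] by (simp add: space_prob_algebra)
  show ?thesis unfolding joint_law_def
    using prob_space_bind'[OF PP measurable_joint_kernel] sets_bind'[OF PP measurable_joint_kernel]
    by (simp add: space_prob_algebra)
qed

lemma prob_space_joint_law: "prob_space (joint_law X Y P M)"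
  and sets_joint_law: "sets (joint_law X Y P M) = sets (X \<Otimes>\<^sub>M Y)"
  using joint_law_in by (auto simp: space_prob_algebra)

lemma measurable_joint_law: "measurable (joint_law X Y P M) K = measurable (X \<Otimes>\<^sub>M Y) K"
  by (rule measurable_cong_sets[OF sets_joint_law refl])

text \<open>The inner bind with point masses is the image of \<open>M x\<close> under
  \<open>Pair x\<close>, so a set is measured section by section. The marginals and all later
  identifications of the joint law rest on this formula.\<close>

lemma emeasure_joint_law:
  assumes S: "S \<in> sets (X \<Otimes>\<^sub>M Y)"
  shows "emeasure (joint_law X Y P M) S = (\<integral>\<^sup>+x. emeasure (M x) (Pair x -` S) \<partial>P)"
proof -
  have PP: "P \<in> space (prob_algebra P)" using distributionsD[OF P] by (simp add: space_prob_algebra)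
  have "emeasure (joint_law X Y P M) S =
      (\<integral>\<^sup>+x. emeasure (M x \<bind> (\<lambda>y. return (X \<Otimes>\<^sub>M Y) (x, y))) S \<partial>P)"
    unfolding joint_law_def by (rule emeasure_bind_prob_algebra[OF PP measurable_joint_kernel S])
  also have "\<dots> = (\<integral>\<^sup>+x. emeasure (M x) (Pair x -` S) \<partial>P)"
  proof (rule nn_integral_cong)
    fix x assume "x \<in> space P"
    then have x: "x \<in> space X" using distributionsD[OF P] by simp
    have "M x \<bind> (\<lambda>y. return (X \<Otimes>\<^sub>M Y) (x, y)) = distr (M x) (X \<Otimes>\<^sub>M Y) (Pair x)"
      using x mechanismD[OF M x] prob_space.not_empty[of "M x"]
      by (intro bind_return_distr') (auto cong: measurable_cong_sets)
    moreover have "Pair x -` S \<inter> space (M x) = Pair x -` S"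
      using sets.sets_into_space[OF S] mechanismD[OF M x] by (auto simp: space_pair_measure)
    ultimately show "emeasure (M x \<bind> (\<lambda>y. return (X \<Otimes>\<^sub>M Y) (x, y))) S = emeasure (M x) (Pair x -` S)"
      using x S mechanismD[OF M x]
      by (simp add: emeasure_distr measurable_cong_sets[of "M x" Y "X \<Otimes>\<^sub>M Y" "X \<Otimes>\<^sub>M Y"])
  qed
  finally show ?thesis .
qed

lemma measurable_emeasure_sections:
  assumes S: "S \<in> sets (X \<Otimes>\<^sub>M Y)"
  shows "(\<lambda>x. emeasure (M x) (Pair x -` S)) \<in> borel_measurable P"
proof -
  have "(\<lambda>x. emeasure (M x) (Pair x -` S)) \<in> borel_measurable X"
  proof (rule emeasure_measurable_subprob_algebra2)
    have "(SIGMA x:space X. Pair x -` S) = S"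
      using sets.sets_into_space[OF S] by (auto simp: space_pair_measure)
    with S show "(SIGMA x:space X. Pair x -` S) \<in> sets (X \<Otimes>\<^sub>M Y)" by simp
    show "M \<in> X \<rightarrow>\<^sub>M subprob_algebra Y"
      using M unfolding mechanism_def by (rule measurable_prob_algebraD)
  qed
  then show ?thesis using distributionsD[OF P] by (simp cong: measurable_cong_sets)
qed

lemma output_law_in: "P \<bind> M \<in> distributions Y"
proof -
  have PP: "P \<in> space (prob_algebra P)" using distributionsD[OF P] by (simp add: space_prob_algebra)
  show ?thesis
    using prob_space_bind'[OF PP measurable_mechanism] sets_bind'[OF PP measurable_mechanism]
    by (simp add: space_prob_algebra)
qed

lemma emeasure_output: "E \<in> sets Y \<Longrightarrow> emeasure (P \<bind> M) E = (\<integral>\<^sup>+x. emeasure (M x) E \<partial>P)"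
  using distributionsD[OF P] by (intro emeasure_bind_prob_algebra[OF _ measurable_mechanism]) (auto simp: space_prob_algebra)

lemma distr_joint_fst: "distr (joint_law X Y P M) X fst = P"
proof (rule measure_eqI)
  fix A assume "A \<in> sets (distr (joint_law X Y P M) X fst)"
  then have A: "A \<in> sets X" by simp
  have *: "fst -` A \<inter> space (X \<Otimes>\<^sub>M Y) = A \<times> space Y"
    using sets.sets_into_space[OF A] by (auto simp: space_pair_measure)
  have "emeasure (distr (joint_law X Y P M) X fst) A = (\<integral>\<^sup>+x. emeasure (M x) (Pair x -` (A \<times> space Y)) \<partial>P)"
    using A sets_eq_imp_space_eq[OF sets_joint_law]
    by (simp add: emeasure_distr measurable_joint_law emeasure_joint_law *)
  also have "\<dots> = (\<integral>\<^sup>+x. indicator A x \<partial>P)"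
  proof (rule nn_integral_cong)
    fix x assume "x \<in> space P"
    then have "x \<in> space X" using distributionsD[OF P] by simp
    from mechanismD[OF M this] show "emeasure (M x) (Pair x -` (A \<times> space Y)) = indicator A x"
      using prob_space.emeasure_space_1[of "M x"] by (simp add: indicator_def)
  qed
  finally show "emeasure (distr (joint_law X Y P M) X fst) A = emeasure P A"
    using A distributionsD[OF P] by simp
qed (use distributionsD[OF P] in simp)

lemma distr_joint_snd: "distr (joint_law X Y P M) Y snd = P \<bind> M"
proof (rule measure_eqI)
  fix A assume "A \<in> sets (distr (joint_law X Y P M) Y snd)"
  then have A: "A \<in> sets Y" by simp
  have *: "snd -` A \<inter> space (X \<Otimes>\<^sub>M Y) = space X \<times> A"
    using sets.sets_into_space[OF A] by (auto simp: space_pair_measure)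
  have "emeasure (distr (joint_law X Y P M) Y snd) A = (\<integral>\<^sup>+x. emeasure (M x) (Pair x -` (space X \<times> A)) \<partial>P)"
    using A sets_eq_imp_space_eq[OF sets_joint_law]
    by (simp add: emeasure_distr measurable_joint_law emeasure_joint_law *)
  also have "\<dots> = (\<integral>\<^sup>+x. emeasure (M x) A \<partial>P)"
    using distributionsD[OF P] by (intro nn_integral_cong) (simp)
  finally show "emeasure (distr (joint_law X Y P M) Y snd) A = emeasure (P \<bind> M) A"
    using A by (simp add: emeasure_output)
qed (use output_law_in in \<open>simp add: space_prob_algebra\<close>)

text \<open>The marginals of the joint law are \<open>P\<close> and \<open>P \<bind> M\<close>;
  mutual information thereby becomes a divergence from their product.\<close>

lemma channel_information_eq_kl_bits:
  "channel_information X Y P M = kl_bits (P \<Otimes>\<^sub>M (P \<bind> M)) (joint_law X Y P M)"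
proof -
  have "distr (joint_law X Y P M) (X \<Otimes>\<^sub>M Y) (\<lambda>\<omega>. (fst \<omega>, snd \<omega>)) = joint_law X Y P M"
    using sets_joint_law by (simp add: distr_id2)
  then show ?thesis
    using prob_space_joint_law
    by (simp add: channel_information_def mutual_information_bits_def kl_bits_def Let_def
        distr_joint_fst distr_joint_snd prob_space.mutual_information_def)
qed

end

text \<open>\<open>M'\<close> feeds its input through \<open>g\<close> into \<open>M\<close> and
  post-processes the output by \<open>h\<close>, while \<open>f\<close> recovers the original input.
  Both the joint law and the product of marginals of \<open>M'\<close> are then images under
  \<open>f\<close> and \<open>h\<close> of those of \<open>M\<close>, and
  \<open>kl_bits_distr_le\<close> applies.\<close>

lemma channel_information_data_processing:
  assumes P: "P \<in> distributions X'" and M: "mechanism X Y M" and M': "mechanism X' Y' M'"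
    and g[measurable]: "g \<in> X' \<rightarrow>\<^sub>M X" and f[measurable]: "f \<in> X \<rightarrow>\<^sub>M X'" and h[measurable]: "h \<in> Y \<rightarrow>\<^sub>M Y'"
    and fg: "\<And>a. a \<in> space X' \<Longrightarrow> f (g a) = a"
    and M'_eq: "\<And>a. a \<in> space X' \<Longrightarrow> M' a = distr (M (g a)) Y' h"
    and fin: "channel_information X' Y' P M' \<noteq> \<infinity>"
  shows "channel_information X' Y' P M' \<le> channel_information X Y (distr P X g) M"
proof -
  define P1 where "P1 = distr P X g"
  have P': "prob_space P" "sets P = sets X'" "space P = space X'"
    using distributionsD[OF P] by auto
  note [measurable_cong] = P'(2)
  have gP: "g \<in> P \<rightarrow>\<^sub>M X" by measurable
  have P1: "P1 \<in> distributions X"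
    using prob_space.prob_space_distr[OF P'(1) gP] by (simp add: P1_def space_prob_algebra)
  have P1': "prob_space P1" "sets P1 = sets X" "space P1 = space X"
    using distributionsD[OF P1] by auto
  let ?J = "joint_law X Y P1 M" and ?\<phi> = "\<lambda>(x, y). (f x, h y)"
  have \<phi>[measurable]: "?\<phi> \<in> X \<Otimes>\<^sub>M Y \<rightarrow>\<^sub>M X' \<Otimes>\<^sub>M Y'" by measurable
  have gin: "g a \<in> space X" if "a \<in> space X'" for a using measurable_space[OF g that] .
  have J': "distr ?J (X' \<Otimes>\<^sub>M Y') ?\<phi> = joint_law X' Y' P M'"
  proof (rule measure_eqI)
    fix S assume "S \<in> sets (distr ?J (X' \<Otimes>\<^sub>M Y') ?\<phi>)"
    then have S: "S \<in> sets (X' \<Otimes>\<^sub>M Y')" by simp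
    let ?S = "?\<phi> -` S \<inter> space (X \<Otimes>\<^sub>M Y)"
    have S'[measurable]: "?S \<in> sets (X \<Otimes>\<^sub>M Y)" using S \<phi> by (rule measurable_sets[rotated])
    have "emeasure (distr ?J (X' \<Otimes>\<^sub>M Y') ?\<phi>) S = emeasure ?J ?S"
      using S sets_eq_imp_space_eq[OF sets_joint_law[OF P1 M]]
      by (subst emeasure_distr) (auto simp: measurable_joint_law[OF P1 M])
    also have "\<dots> = (\<integral>\<^sup>+x. emeasure (M x) (Pair x -` ?S) \<partial>P1)"
      by (rule emeasure_joint_law[OF P1 M S'])
    also have "\<dots> = (\<integral>\<^sup>+a. emeasure (M (g a)) (Pair (g a) -` ?S) \<partial>P)"
      using measurable_emeasure_sections[OF P1 M S'] unfolding P1_def by (rule nn_integral_distr[OF gP])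
    also have "\<dots> = (\<integral>\<^sup>+a. emeasure (M' a) (Pair a -` S) \<partial>P)"
    proof (rule nn_integral_cong)
      fix a assume "a \<in> space P"
      then have a: "a \<in> space X'" using P' by simp
      note Mga = mechanismD[OF M gin[OF a]]
      have [simp]: "measurable (M (g a)) Y' = measurable Y Y'"
        by (rule measurable_cong_sets[OF Mga(2) refl])
      \<comment> \<open>Since \<open>f (g a) = a\<close>, the section of the preimage at
        \<open>g a\<close> is the \<open>h\<close>-preimage of the section at
        \<open>a\<close>.\<close>
      have "Pair (g a) -` ?S = h -` (Pair a -` S) \<inter> space (M (g a))"
        using gin[OF a] Mga fg[OF a] by (auto simp: space_pair_measure)
      then show "emeasure (M (g a)) (Pair (g a) -` ?S) = emeasure (M' a) (Pair a -` S)"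
        unfolding M'_eq[OF a] using sets_Pair1[OF S] h by (subst emeasure_distr) auto
    qed
    also have "\<dots> = emeasure (joint_law X' Y' P M') S"
      by (rule emeasure_joint_law[OF P M' S, symmetric])
    finally show "emeasure (distr ?J (X' \<Otimes>\<^sub>M Y') ?\<phi>) S = emeasure (joint_law X' Y' P M') S" .
  qed (simp add: sets_joint_law[OF P M'])
  have hB: "h \<in> (P1 \<bind> M) \<rightarrow>\<^sub>M Y'"
    using output_law_in[OF P1 M] h by (auto simp: space_prob_algebra cong: measurable_cong_sets)
  have B': "distr (P1 \<bind> M) Y' h = P \<bind> M'"
  proof -
    have "P \<bind> M' = distr (distr ?J (X' \<Otimes>\<^sub>M Y') ?\<phi>) Y' snd"
      unfolding J' by (rule distr_joint_snd[OF P M', symmetric])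
    also have "\<dots> = distr ?J Y' (h \<circ> snd)"
      by (subst distr_distr) (auto simp: measurable_joint_law[OF P1 M] comp_def case_prod_beta)
    also have "\<dots> = distr (distr ?J Y snd) Y' h"
      by (subst distr_distr) (auto simp: measurable_joint_law[OF P1 M])
    finally show ?thesis by (simp add: distr_joint_snd[OF P1 M])
  qed
  have fP1: "distr P1 X' f = P"
  proof -
    have "distr P1 X' f = distr P X' (f \<circ> g)"
      unfolding P1_def using gP f by (rule distr_distr[rotated])
    also have "\<dots> = distr P P (\<lambda>x. x)"
      using P' fg by (intro distr_cong) auto
    finally show ?thesis by simp
  qed
  have fm: "f \<in> P1 \<rightarrow>\<^sub>M X'" using f P1'(2) by (simp cong: measurable_cong_sets)
  interpret B: prob_space "P1 \<bind> M" using output_law_in[OF P1 M] by (simp add: space_prob_algebra)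
  interpret P1: prob_space P1 by fact
  interpret PB: pair_prob_space P1 "P1 \<bind> M" ..
  have Bs: "sets (P1 \<bind> M) = sets Y" using output_law_in[OF P1 M] by (simp add: space_prob_algebra)
  have Q': "distr (P1 \<Otimes>\<^sub>M (P1 \<bind> M)) (X' \<Otimes>\<^sub>M Y') ?\<phi> = P \<Otimes>\<^sub>M (P \<bind> M')"
    using pair_measure_distr[OF fm hB] prob_space_imp_sigma_finite[OF B.prob_space_distr[OF hB]]
    unfolding fP1 B' by simp
  have sJ: "sets ?J = sets (P1 \<Otimes>\<^sub>M (P1 \<bind> M))"
    unfolding sets_joint_law[OF P1 M] by (rule sets_pair_measure_cong) (simp_all add: P1' Bs)
  have "kl_bits (P \<Otimes>\<^sub>M (P \<bind> M')) (joint_law X' Y' P M') \<le> kl_bits (P1 \<Otimes>\<^sub>M (P1 \<bind> M)) ?J"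
    unfolding Q'[symmetric] J'[symmetric]
  proof (rule kl_bits_distr_le)
    show "?\<phi> \<in> P1 \<Otimes>\<^sub>M (P1 \<bind> M) \<rightarrow>\<^sub>M X' \<Otimes>\<^sub>M Y'"
      unfolding measurable_cong_sets[OF sJ[symmetric] refl] measurable_joint_law[OF P1 M] by (rule \<phi>)
    show "kl_bits (distr (P1 \<Otimes>\<^sub>M (P1 \<bind> M)) (X' \<Otimes>\<^sub>M Y') ?\<phi>) (distr ?J (X' \<Otimes>\<^sub>M Y') ?\<phi>) \<noteq> \<infinity>"
      using fin unfolding Q' J' channel_information_eq_kl_bits[OF P M'] .
  qed (rule PB.prob_space_axioms prob_space_joint_law[OF P1 M] sJ)+
  then show ?thesis
    by (simp add: channel_information_eq_kl_bits[OF P M'] channel_information_eq_kl_bits[OF P1 M]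
        flip: P1_def)
qed

subsection \<open>Mechanisms with binary output\<close>

text \<open>The indicator form covers all four events by one expression that is affine in
  \<open>p\<close>, so it passes through averages over \<open>p\<close>.\<close>

lemma emeasure_bernoulli:
  assumes "0 \<le> p" "p \<le> 1"
  shows "emeasure (measure_pmf (bernoulli_pmf p)) A = ennreal (indicator A True * p + indicator A False * (1 - p))"
proof -
  have "emeasure (measure_pmf (bernoulli_pmf p)) A = (\<integral>\<^sup>+b. indicator A b \<partial>bernoulli_pmf p)"
    by simp
  also have "\<dots> = indicator A True * ennreal p + indicator A False * ennreal (1 - p)"
    by (subst nn_integral_bernoulli_pmf) (use assms in auto)
  finally show ?thesis using assms by (auto simp: indicator_def simp flip: ennreal_plus)
qed

lemma mechanism_bernoulli:
  assumes [measurable]: "w \<in> borel_measurable X" and w: "\<And>x. x \<in> space X \<Longrightarrow> w x \<in> {0..1}"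
  shows "mechanism X (count_space UNIV) (\<lambda>x. measure_pmf (bernoulli_pmf (w x)))"
  unfolding mechanism_def
proof (intro measurable_prob_algebraI measurable_subprob_algebra)
  fix A :: "bool set"
  have "(\<lambda>x. ennreal (indicator A True * w x + indicator A False * (1 - w x))) \<in> borel_measurable X"
    by measurable
  then show "(\<lambda>x. emeasure (measure_pmf (bernoulli_pmf (w x))) A) \<in> borel_measurable X"
    by (subst measurable_cong[OF emeasure_bernoulli]) (use w in auto)
qed (auto intro: measure_pmf.prob_space_axioms measure_pmf.subprob_space_axioms)

text \<open>Event probabilities are affine in the parameter, so a mixture of Bernoulli laws is the
  Bernoulli law with the mean parameter.\<close>

lemma bernoulli_output:
  assumes P: "P \<in> distributions X" and [measurable]: "w \<in> borel_measurable X"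
    and w: "\<And>x. x \<in> space X \<Longrightarrow> w x \<in> {0..1}"
  defines "q \<equiv> \<integral>x. w x \<partial>P"
  shows "q \<in> {0..1}" and "P \<bind> (\<lambda>x. measure_pmf (bernoulli_pmf (w x))) = measure_pmf (bernoulli_pmf q)"
    and "integrable P w"
proof -
  have M: "mechanism X (count_space UNIV) (\<lambda>x. measure_pmf (bernoulli_pmf (w x)))"
    by (rule mechanism_bernoulli) (use w in auto)
  note P' = distributionsD[OF P]
  interpret prob_space P by (rule P')
  have [measurable]: "w \<in> borel_measurable P" using P'(2) by (simp cong: measurable_cong_sets)
  have bd: "AE x in P. 0 \<le> w x" "AE x in P. w x \<le> 1" using w P' by auto
  show int[simp]: "integrable P w"
    by (rule integrable_const_bound[where B=1]) (use bd in \<open>auto elim: eventually_elim2\<close>)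
  show q: "q \<in> {0..1}"
    unfolding q_def using integral_nonneg_AE[OF bd(1)] integral_le_const[OF int bd(2)] by auto
  show "P \<bind> (\<lambda>x. measure_pmf (bernoulli_pmf (w x))) = measure_pmf (bernoulli_pmf q)"
  proof (rule measure_eqI)
    fix A :: "bool set"
    let ?g = "\<lambda>w. indicator A True * w + indicator A False * (1 - w) :: real"
    have "emeasure (P \<bind> (\<lambda>x. measure_pmf (bernoulli_pmf (w x)))) A =
        (\<integral>\<^sup>+x. emeasure (measure_pmf (bernoulli_pmf (w x))) A \<partial>P)"
      by (rule emeasure_output[OF P M]) (simp only: sets_count_space Pow_UNIV UNIV_I)
    also have "\<dots> = (\<integral>\<^sup>+x. ennreal (?g (w x)) \<partial>P)"
      using w P' by (intro nn_integral_cong) (simp add: emeasure_bernoulli)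
    also have "\<dots> = ennreal (\<integral>x. ?g (w x) \<partial>P)"
      using bd by (intro nn_integral_eq_integral) (auto elim: eventually_elim2 simp: indicator_def)
    also have "(\<integral>x. ?g (w x) \<partial>P) = ?g q"
      by (simp add: q_def prob_space)
    also have "ennreal (?g q) = emeasure (measure_pmf (bernoulli_pmf q)) A"
      using q by (simp add: emeasure_bernoulli)
    finally show "emeasure (P \<bind> (\<lambda>x. measure_pmf (bernoulli_pmf (w x)))) A =
        emeasure (measure_pmf (bernoulli_pmf q)) A" .
  next
    show "sets (P \<bind> (\<lambda>x. measure_pmf (bernoulli_pmf (w x)))) = sets (measure_pmf (bernoulli_pmf q))"
      using output_law_in[OF P M] by (simp add: space_prob_algebra)
  qed
qed

text \<open>The identity I(X;B) = H(B) - H(B|X). Finitely many parameters make every integrand a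
  simple function, so no integrability question arises.\<close>

lemma channel_information_bernoulli:
  assumes P: "P \<in> distributions X" and wm[measurable]: "w \<in> borel_measurable X"
    and w: "\<And>x. x \<in> space X \<Longrightarrow> w x \<in> {0..1}" and fin: "finite (w ` space X)"
  shows "channel_information X (count_space UNIV) P (\<lambda>x. measure_pmf (bernoulli_pmf (w x))) =
    ereal (binary_entropy (\<integral>x. w x \<partial>P) - (\<integral>x. binary_entropy (w x) \<partial>P))"
proof -
  have M: "mechanism X (count_space UNIV) (\<lambda>x. measure_pmf (bernoulli_pmf (w x)))"
    by (rule mechanism_bernoulli) (use w in auto)
  note P' = distributionsD[OF P]
  interpret prob_space P by (rule P')
  note [measurable_cong] = P'(2)
  define q where "q = (\<integral>x. w x \<partial>P)"
  have out: "q \<in> {0..1}" "P \<bind> (\<lambda>x. measure_pmf (bernoulli_pmf (w x))) = measure_pmf (bernoulli_pmf q)"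
      "integrable P w"
    unfolding q_def by (rule bernoulli_output[OF P wm]; use w in auto)+
  have q: "0 \<le> q" "q \<le> 1" using out(1) by auto
  let ?Q = "measure_pmf (bernoulli_pmf q)" and ?M = "\<lambda>x. measure_pmf (bernoulli_pmf (w x))"
  \<comment> \<open>The output probability at \<open>x\<close> divided by the marginal one, which is
    the density of the joint law against the product. Outside \<open>space X\<close>, where
    \<open>w\<close> is unconstrained, the value 0 keeps \<open>f\<close> nonnegative
    everywhere.\<close>
  define f :: "'a \<times> bool \<Rightarrow> real" where
    "f = (\<lambda>(x, b). if x \<in> space X then if b then w x / q else (1 - w x) / (1 - q) else 0)"
  have f0: "0 \<le> f z" for z using w q by (auto simp: f_def split: prod.split)
  have f_m[measurable]: "f \<in> borel_measurable (P \<Otimes>\<^sub>M ?Q)"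
    unfolding f_def case_prod_beta by measurable
  \<comment> \<open>When \<open>q\<close> is 0 or 1, \<open>f\<close> divides by zero and takes the
    value 0 there. A nonnegative function with mean zero vanishes almost everywhere, so the output
    of marginal probability zero is almost never produced and this value does no harm.\<close>
  have "AE x in P. q = 0 \<longrightarrow> w x = 0"
  proof (cases "q = 0")
    case True
    then have "(\<integral>x. w x \<partial>P) = 0" by (simp add: q_def)
    then have "AE x in P. w x = 0"
      by (subst (asm) integral_nonneg_eq_0_iff_AE) (use out w P' in auto)
    then show ?thesis by eventually_elim simp
  qed simp
  moreover have "AE x in P. 1 - q = 0 \<longrightarrow> 1 - w x = 0"
  proof (cases "1 - q = 0")
    case True
    then have "(\<integral>x. 1 - w x \<partial>P) = 0" using out by (simp add: q_def prob_space)
    then have "AE x in P. 1 - w x = 0"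
      by (subst (asm) integral_nonneg_eq_0_iff_AE) (use out w P' in auto)
    then show ?thesis by eventually_elim simp
  qed simp
  ultimately have AEx: "AE x in P. x \<in> space X \<and> w x \<in> {0..1} \<and> (q = 0 \<longrightarrow> w x = 0) \<and> (q = 1 \<longrightarrow> w x = 1)"
    using AE_space by eventually_elim (use w P' in auto)

  interpret PQ: pair_prob_space P ?Q ..
  have J: "joint_law X (count_space UNIV) P ?M = density (P \<Otimes>\<^sub>M ?Q) f"
  proof (rule measure_eqI)
    have "sets (X \<Otimes>\<^sub>M (count_space UNIV :: bool measure)) = sets (P \<Otimes>\<^sub>M ?Q)"
      by (rule sets_pair_measure_cong) (simp_all add: P')
    then show s: "sets (joint_law X (count_space UNIV) P ?M) = sets (density (P \<Otimes>\<^sub>M ?Q) f)"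
      by (simp add: sets_joint_law[OF P M])
    fix S assume S: "S \<in> sets (joint_law X (count_space UNIV) P ?M)"
    then have S'[measurable]: "S \<in> sets (P \<Otimes>\<^sub>M ?Q)" using s by simp
    have "emeasure (density (P \<Otimes>\<^sub>M ?Q) f) S = (\<integral>\<^sup>+z. ennreal (f z) * indicator S z \<partial>(P \<Otimes>\<^sub>M ?Q))"
      by (rule emeasure_density) auto
    also have "\<dots> = (\<integral>\<^sup>+x. \<integral>\<^sup>+b. ennreal (f (x, b)) * indicator S (x, b) \<partial>?Q \<partial>P)"
      by (rule measure_pmf.nn_integral_fst[of "\<lambda>z. ennreal (f z) * indicator S z", symmetric]) auto
    also have "\<dots> = (\<integral>\<^sup>+x. emeasure (?M x) (Pair x -` S) \<partial>P)"
    proof (rule nn_integral_cong_AE, use AEx in eventually_elim)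
      fix x assume x: "x \<in> space X \<and> w x \<in> {0..1} \<and> (q = 0 \<longrightarrow> w x = 0) \<and> (q = 1 \<longrightarrow> w x = 1)"
      then have 1: "f (x, True) * q = w x" "f (x, False) * (1 - q) = 1 - w x"
        by (auto simp: f_def)
      have "(\<integral>\<^sup>+b. ennreal (f (x, b)) * indicator S (x, b) \<partial>?Q) =
         ennreal (f (x, True) * q) * indicator S (x, True) +
         ennreal (f (x, False) * (1 - q)) * indicator S (x, False)"
        using q f0 by (subst nn_integral_bernoulli_pmf) (auto simp: ennreal_mult mult_ac)
      also have "\<dots> = emeasure (?M x) (Pair x -` S)"
        unfolding 1 using x by (auto simp: emeasure_bernoulli indicator_def simp flip: ennreal_plus)
      finally show "(\<integral>\<^sup>+b. ennreal (f (x, b)) * indicator S (x, b) \<partial>?Q) = emeasure (?M x) (Pair x -` S)" .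
    qed
    also have "\<dots> = emeasure (joint_law X (count_space UNIV) P ?M) S"
      using S by (intro emeasure_joint_law[OF P M, symmetric]) (simp only: sets_joint_law[OF P M])
    finally show "emeasure (joint_law X (count_space UNIV) P ?M) S = emeasure (density (P \<Otimes>\<^sub>M ?Q) f) S"
      by simp
  qed

  let ?L = "\<lambda>z. f z * log 2 (f z)"
  \<comment> \<open>For fixed \<open>q\<close>, \<open>f\<close> depends only on the bit and on
    \<open>w x\<close>, so it inherits a finite range.\<close>
  have "finite (f ` space (P \<Otimes>\<^sub>M ?Q))"
  proof (rule finite_subset)
    show "f ` space (P \<Otimes>\<^sub>M ?Q) \<subseteq> (\<lambda>v. v / q) ` w ` space X \<union> (\<lambda>v. (1 - v) / (1 - q)) ` w ` space X"
    proof (rule image_subsetI)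
      fix z assume "z \<in> space (P \<Otimes>\<^sub>M ?Q)"
      then obtain x b where z: "z = (x, b)" "x \<in> space X" by (auto simp: space_pair_measure P')
      then have "f z = (if b then w x / q else (1 - w x) / (1 - q))" by (simp add: f_def)
      then have "f z = (\<lambda>v. v / q) (w x) \<or> f z = (\<lambda>v. (1 - v) / (1 - q)) (w x)" by simp
      then show "f z \<in> (\<lambda>v. v / q) ` w ` space X \<union> (\<lambda>v. (1 - v) / (1 - q)) ` w ` space X"
        using z(2) by (metis UnI1 UnI2 imageI)
    qed
  qed (use fin in auto)
  then have "finite (?L ` space (P \<Otimes>\<^sub>M ?Q))"
    by (drule_tac finite_imageI[where h="\<lambda>v. v * log 2 v"]) (simp add: image_image)
  then have "simple_function (P \<Otimes>\<^sub>M ?Q) ?L"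
    by (intro simple_function_borel_measurable) auto
  then have int: "integrable (P \<Otimes>\<^sub>M ?Q) ?L"
    by (intro integrable_simple_function) auto
  have intw: "integrable P (\<lambda>x. binary_entropy (w x))"
  proof (rule integrable_simple_function)
    have "finite ((\<lambda>x. binary_entropy (w x)) ` space P)"
      unfolding P' using finite_imageI[OF fin, of binary_entropy] by (simp add: image_image)
    then show "simple_function P (\<lambda>x. binary_entropy (w x))"
      by (intro simple_function_borel_measurable) (auto simp: binary_entropy_def)
  qed auto
  have "(\<integral>z. ?L z \<partial>(P \<Otimes>\<^sub>M ?Q)) = (\<integral>x. \<integral>b. ?L (x, b) \<partial>?Q \<partial>P)"
    by (rule PQ.integral_fst'[OF int, symmetric])
  also have "\<dots> = (\<integral>x. - binary_entropy (w x) - w x * log 2 q - (1 - w x) * log 2 (1 - q) \<partial>P)"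
  proof (rule integral_cong_AE)
    show "AE x in P. (\<integral>b. ?L (x, b) \<partial>?Q) = - binary_entropy (w x) - w x * log 2 q - (1 - w x) * log 2 (1 - q)"
      using AEx
    proof eventually_elim
      fix x assume x: "x \<in> space X \<and> w x \<in> {0..1} \<and> (q = 0 \<longrightarrow> w x = 0) \<and> (q = 1 \<longrightarrow> w x = 1)"
      \<comment> \<open>The case \<open>w x = 0\<close> is separate because the logarithm of the
        quotient does not split there; the factor makes both sides 0.\<close>
      have *: "?L (x, True) * q = w x * (log 2 (w x) - log 2 q)"
        using x q by (cases "w x = 0") (auto simp: f_def log_divide less_le)
      have **: "?L (x, False) * (1 - q) = (1 - w x) * (log 2 (1 - w x) - log 2 (1 - q))"
        using x q by (cases "w x = 1") (auto simp: f_def log_divide less_le)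
      show "(\<integral>b. ?L (x, b) \<partial>?Q) = - binary_entropy (w x) - w x * log 2 q - (1 - w x) * log 2 (1 - q)"
        using q * ** by (simp add: binary_entropy_def algebra_simps)
    qed
  qed (auto simp: binary_entropy_def)
  \<comment> \<open>Averaging the terms affine in \<open>w x\<close> replaces \<open>w x\<close> by
    \<open>q\<close> and leaves exactly the entropy of the output.\<close>
  also have "\<dots> = binary_entropy q - (\<integral>x. binary_entropy (w x) \<partial>P)"
    using out(3) intw by (simp add: prob_space binary_entropy_def[of q] flip: q_def)
  finally have val: "(\<integral>z. ?L z \<partial>(P \<Otimes>\<^sub>M ?Q)) = binary_entropy q - (\<integral>x. binary_entropy (w x) \<partial>P)" .
  show ?thesis
    unfolding channel_information_eq_kl_bits[OF P M] out(2) J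
    by (subst kl_bits_density) (use PQ.prob_space_axioms int f0 val in \<open>auto simp: q_def\<close>)
qed

text \<open>Mutual information when the input bit is 1 with probability \<open>t\<close> and the
  output bit is 1 with probability \<open>p\<^sub>0\<close> or \<open>p\<^sub>1\<close> on input 0
  or 1: the Jensen gap of the binary entropy. The second parameter is one minus a crossover
  probability.\<close>

definition binary_information :: "real \<Rightarrow> real \<Rightarrow> real \<Rightarrow> real" where
  "binary_information p\<^sub>0 p\<^sub>1 t =
     binary_entropy ((1 - t) * p\<^sub>0 + t * p\<^sub>1) - (1 - t) * binary_entropy p\<^sub>0 - t * binary_entropy p\<^sub>1"

text \<open>The input law enters only through the mass of \<open>A\<close>. With
  \<open>A = {True}\<close> this describes the binary asymmetric channel, with a singleton of data
  points the extremal mechanism.\<close>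

lemma channel_information_two_level:
  assumes P: "P \<in> distributions X" and A[measurable]: "A \<in> sets X"
    and p: "p\<^sub>0 \<in> {0..1}" "p\<^sub>1 \<in> {0..1}"
  shows "channel_information X (count_space UNIV) P
      (\<lambda>x. measure_pmf (bernoulli_pmf (if x \<in> A then p\<^sub>1 else p\<^sub>0))) =
    ereal (binary_information p\<^sub>0 p\<^sub>1 (measure P A))"
proof -
  let ?w = "\<lambda>x. if x \<in> A then p\<^sub>1 else p\<^sub>0"
  have P': "prob_space P" "sets P = sets X" using P by (auto simp: space_prob_algebra)
  interpret prob_space P by (rule P')
  have A': "A \<in> sets P" using A P' by simp
  have ind: "integrable P (indicator A :: _ \<Rightarrow> real)"
    using A' by (intro integrable_real_indicator) (simp_all add: less_top[symmetric])
  have mix: "(\<integral>x. (if x \<in> A then c else d) \<partial>P) = (1 - measure P A) * d + measure P A * c" for c d :: real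
  proof -
    have "(\<integral>x. (if x \<in> A then c else d) \<partial>P) = (\<integral>x. d + (c - d) * indicator A x \<partial>P)"
      by (intro Bochner_Integration.integral_cong) auto
    also have "\<dots> = d + (c - d) * measure P A"
      using A' ind by (subst Bochner_Integration.integral_add) (auto simp: prob_space)
    finally show ?thesis by (simp add: algebra_simps)
  qed
  have fin: "finite (?w ` space X)"
    by (rule finite_subset[of _ "{p\<^sub>0, p\<^sub>1}"]) auto
  have "(\<integral>x. binary_entropy (?w x) \<partial>P) = (\<integral>x. (if x \<in> A then binary_entropy p\<^sub>1 else binary_entropy p\<^sub>0) \<partial>P)"
    by (intro Bochner_Integration.integral_cong) auto
  then have ent: "(\<integral>x. binary_entropy (?w x) \<partial>P) = (1 - measure P A) * binary_entropy p\<^sub>0 + measure P A * binary_entropy p\<^sub>1"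
    by (simp only: mix)
  show ?thesis
    using p by (subst channel_information_bernoulli[OF P _ _ fin])
      (auto simp: mix ent binary_information_def)
qed

text \<open>Only the mass of \<open>{True}\<close> matters, and Bernoulli input laws realize every
  mass in the unit interval.\<close>

lemma C_BAC_eq:
  assumes "\<epsilon>\<^sub>0 \<in> {0..1}" "\<epsilon>\<^sub>1 \<in> {0..1}"
  shows "C_BAC \<epsilon>\<^sub>0 \<epsilon>\<^sub>1 = (SUP t\<in>{0..1}. ereal (binary_information \<epsilon>\<^sub>0 (1 - \<epsilon>\<^sub>1) t))"
proof -
  have info: "channel_information (count_space UNIV) (count_space UNIV) P (bac \<epsilon>\<^sub>0 \<epsilon>\<^sub>1) =
      ereal (binary_information \<epsilon>\<^sub>0 (1 - \<epsilon>\<^sub>1) (measure P {True}))"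
    if "P \<in> distributions (count_space UNIV)" for P
    using channel_information_two_level[OF that, of "{True}" \<epsilon>\<^sub>0 "1 - \<epsilon>\<^sub>1"] assms
    by (simp add: bac_def[abs_def])
  have "measure P {True} \<in> {0..1}" if "P \<in> distributions (count_space UNIV)" for P
    using that by (auto simp: space_prob_algebra prob_space.prob_le_1)
  moreover have "t \<in> (\<lambda>P. measure P {True}) ` distributions (count_space UNIV)" if "t \<in> {0..1}" for t :: real
    using that by (intro image_eqI[of _ _ "measure_pmf (bernoulli_pmf t)"])
      (auto simp: space_prob_algebra measure_pmf_single measure_pmf.prob_space_axioms)
  ultimately have "(\<lambda>P. measure P {True}) ` distributions (count_space UNIV) = {0..1}" by blast
  then have "(SUP t\<in>{0..1}. ereal (binary_information \<epsilon>\<^sub>0 (1 - \<epsilon>\<^sub>1) t)) =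
      (SUP t\<in>(\<lambda>P. measure P {True}) ` distributions (count_space UNIV). ereal (binary_information \<epsilon>\<^sub>0 (1 - \<epsilon>\<^sub>1) t))"
    by simp
  then show ?thesis
    unfolding C_BAC_def image_comp by (simp add: info cong: SUP_cong_simp)
qed

subsection \<open>Capacity of the binary asymmetric channel\<close>

lemma binary_entropy_minus: "binary_entropy (1 - p) = binary_entropy p"
  by (simp add: binary_entropy_def algebra_simps)

text \<open>The bound \<open>ln y \<le> y - 1\<close> at \<open>y = 1 / sqrt x\<close> dominates the
  absolute value of \<open>x * ln x\<close> by \<open>2 * sqrt x\<close> on the open unit
  interval.\<close>

lemma tendsto_x_ln_x: "((\<lambda>x::real. x * ln x) \<longlongrightarrow> 0) (at_right 0)"
proof (rule Lim_null_comparison)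
  have "eventually (\<lambda>x::real. x \<in> {0<..<1}) (at_right 0)"
    by (rule eventually_at_right_real) simp
  then show "eventually (\<lambda>x::real. norm (x * ln x) \<le> 2 * sqrt x) (at_right 0)"
  proof eventually_elim
    fix x :: real assume x: "x \<in> {0<..<1}"
    then have "ln (1 / sqrt x) \<le> 1 / sqrt x - 1" by (intro ln_le_minus_one) simp
    then have "- ln x \<le> 2 / sqrt x" using x by (simp add: ln_div ln_sqrt)
    then have "x * (- ln x) \<le> x * (2 / sqrt x)" using x by (intro mult_left_mono) auto
    also have "x * (2 / sqrt x) = 2 * (x / sqrt x)" by simp
    also have "\<dots> = 2 * sqrt x" using x by (simp add: real_div_sqrt)
    finally show "norm (x * ln x) \<le> 2 * sqrt x" using x by (simp add: abs_mult)
  qed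
  have "((\<lambda>x::real. 2 * sqrt x) \<longlongrightarrow> 2 * sqrt 0) (at_right 0)"
    by (intro tendsto_intros)
  then show "((\<lambda>x::real. 2 * sqrt x) \<longlongrightarrow> 0) (at_right 0)" by simp
qed

lemma continuous_on_x_ln_x: "continuous_on {0..} (\<lambda>x::real. x * ln x)"
  unfolding continuous_on_eq_continuous_within
proof
  fix x :: real assume "x \<in> {0..}"
  then consider "x = 0" | "0 < x" by fastforce
  then show "continuous (at x within {0..}) (\<lambda>x. x * ln x)"
  proof cases
    case 1
    have "{0..} - {0} = {0<..} - {0::real}" by auto
    then have "at 0 within {0..} = (at_right 0 :: real filter)"
      by (simp only: at_within_def)
    with 1 show ?thesis using tendsto_x_ln_x by (simp add: continuous_within)
  qed (auto intro!: continuous_intros)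
qed

lemma continuous_on_binary_entropy: "continuous_on {0..1} binary_entropy"
proof -
  have "continuous_on {0..1} (\<lambda>p. - (p * ln p + (1 - p) * ln (1 - p)) / ln 2 :: real)"
    by (intro continuous_intros continuous_on_subset[OF continuous_on_x_ln_x]
        continuous_on_compose2[OF continuous_on_x_ln_x, of _ "\<lambda>p. 1 - p"]) auto
  moreover have "binary_entropy = (\<lambda>p. - (p * ln p + (1 - p) * ln (1 - p)) / ln 2)"
    by (auto simp: binary_entropy_def log_def fun_eq_iff field_simps)
  ultimately show ?thesis by (simp only:)
qed

text \<open>Gibbs' inequality: \<open>ln z \<le> z - 1\<close> is applied to both outcomes, and the
  two linear errors cancel. The right-hand side is affine in \<open>q\<close> and touches the
  entropy at \<open>q = r\<close>, so this is also the tangent-line form of concavity.\<close>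

lemma binary_entropy_le_cross_entropy:
  assumes q: "q \<in> {0..1}" and r: "0 < r" "r < 1"
  shows "binary_entropy q \<le> - q * log 2 r - (1 - q) * log 2 (1 - r)"
proof -
  have *: "x * log 2 y - x * log 2 x \<le> (y - x) / ln 2" if "0 \<le> x" "0 < y" for x y :: real
  proof (cases "x = 0")
    case False
    then have x: "0 < x" using that by simp
    then have "x * ln (y / x) \<le> x * (y / x - 1)"
      using that by (intro mult_left_mono ln_le_minus_one) auto
    then have "x * ln y - x * ln x \<le> y - x"
      using x that by (simp add: ln_div algebra_simps)
    then have "(x * ln y - x * ln x) / ln 2 \<le> (y - x) / ln 2" by (intro divide_right_mono) auto
    then show ?thesis by (simp add: log_def diff_divide_distrib)
  qed (use that in simp)
  show ?thesis
    using *[of q r] *[of "1 - q" "1 - r"] q r by (simp add: binary_entropy_def diff_divide_distrib)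
qed

section \<open>Symmetries and vanishing of the capacity\<close>

lemma SUP_reflect: "(SUP t\<in>{0..1}. f (1 - t)) = (SUP t\<in>{0..1::real}. f t)"
  for f :: "real \<Rightarrow> ereal"
proof -
  have "(\<lambda>t. 1 - t) ` {0..1} = {0..1::real}"
    by (auto intro: image_eqI[of _ _ "1 - _"])
  then show ?thesis by (metis image_image)
qed

lemma binary_information_swap: "binary_information p\<^sub>1 p\<^sub>0 t = binary_information p\<^sub>0 p\<^sub>1 (1 - t)"
  by (simp add: binary_information_def add.commute)

lemma binary_information_reflect:
  "binary_information (1 - p\<^sub>0) (1 - p\<^sub>1) t = binary_information p\<^sub>0 p\<^sub>1 t"
proof -
  have "(1 - t) * (1 - p\<^sub>0) + t * (1 - p\<^sub>1) = 1 - ((1 - t) * p\<^sub>0 + t * p\<^sub>1)"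
    by (simp add: algebra_simps)
  then show ?thesis by (simp add: binary_information_def binary_entropy_minus del: diff_diff_eq2)
qed

text \<open>The first identity renames the inputs (replacing \<open>t\<close> by
  \<open>1 - t\<close>), the second renames the outputs, and the third is their composition.\<close>

lemma C_BAC_symmetries:
  assumes e: "\<epsilon>\<^sub>0 \<in> {0..1}" "\<epsilon>\<^sub>1 \<in> {0..1}"
  shows "C_BAC (1 - \<epsilon>\<^sub>1) (1 - \<epsilon>\<^sub>0) = C_BAC \<epsilon>\<^sub>0 \<epsilon>\<^sub>1"
    and "C_BAC (1 - \<epsilon>\<^sub>0) (1 - \<epsilon>\<^sub>1) = C_BAC \<epsilon>\<^sub>0 \<epsilon>\<^sub>1"
    and "C_BAC \<epsilon>\<^sub>1 \<epsilon>\<^sub>0 = C_BAC \<epsilon>\<^sub>0 \<epsilon>\<^sub>1"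
proof -
  have 1: "C_BAC (1 - \<epsilon>\<^sub>1) (1 - \<epsilon>\<^sub>0) = C_BAC \<epsilon>\<^sub>0 \<epsilon>\<^sub>1" if "\<epsilon>\<^sub>0 \<in> {0..1}" "\<epsilon>\<^sub>1 \<in> {0..1}" for \<epsilon>\<^sub>0 \<epsilon>\<^sub>1
    using that SUP_reflect[of "\<lambda>t. ereal (binary_information \<epsilon>\<^sub>0 (1 - \<epsilon>\<^sub>1) t)"]
    by (simp add: C_BAC_eq binary_information_swap[of "1 - \<epsilon>\<^sub>1"])
  show "C_BAC (1 - \<epsilon>\<^sub>1) (1 - \<epsilon>\<^sub>0) = C_BAC \<epsilon>\<^sub>0 \<epsilon>\<^sub>1" by (rule 1[OF e])
  show 2: "C_BAC (1 - \<epsilon>\<^sub>0) (1 - \<epsilon>\<^sub>1) = C_BAC \<epsilon>\<^sub>0 \<epsilon>\<^sub>1"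
    using e binary_information_reflect[of \<epsilon>\<^sub>0 "1 - \<epsilon>\<^sub>1"] by (simp add: C_BAC_eq)
  show "C_BAC \<epsilon>\<^sub>1 \<epsilon>\<^sub>0 = C_BAC \<epsilon>\<^sub>0 \<epsilon>\<^sub>1"
    using 1[of "1 - \<epsilon>\<^sub>0" "1 - \<epsilon>\<^sub>1"] 2 e by simp
qed

text \<open>Both inputs produce a 1 with the same probability, so the output is independent of the
  input.\<close>

lemma C_BAC_zero:
  assumes "p \<in> {0..1}"
  shows "C_BAC p (1 - p) = 0"
proof -
  have "binary_information p p t = 0" for t
    by (simp add: binary_information_def algebra_simps)
  then show ?thesis using assms by (simp add: C_BAC_eq zero_ereal_def)
qed

text \<open>The condition \<open>\<epsilon>\<^sub>0 + \<epsilon>\<^sub>1 < 1\<close> orders the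
  reachable output laws as the interval from \<open>p\<^sub>0\<close> to \<open>p\<^sub>1\<close>.
  The main point is that the maximizer \<open>r\<close> over the whole unit interval lies in it;
  this follows from concavity of the entropy.\<close>

lemma C_BAC_formula:
  assumes e: "\<epsilon>\<^sub>0 \<in> {0..1}" "\<epsilon>\<^sub>1 \<in> {0..1}" and lt: "\<epsilon>\<^sub>0 + \<epsilon>\<^sub>1 < 1"
  shows "C_BAC \<epsilon>\<^sub>0 \<epsilon>\<^sub>1 =
    ereal (\<epsilon>\<^sub>0 / (1 - \<epsilon>\<^sub>0 - \<epsilon>\<^sub>1) * binary_entropy \<epsilon>\<^sub>1
      - (1 - \<epsilon>\<^sub>1) / (1 - \<epsilon>\<^sub>0 - \<epsilon>\<^sub>1) * binary_entropy \<epsilon>\<^sub>0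
      + log 2 (1 + 2 powr ((binary_entropy \<epsilon>\<^sub>0 - binary_entropy \<epsilon>\<^sub>1) / (1 - \<epsilon>\<^sub>0 - \<epsilon>\<^sub>1))))"
proof -
  define p\<^sub>0 p\<^sub>1 where "p\<^sub>0 = \<epsilon>\<^sub>0" and "p\<^sub>1 = 1 - \<epsilon>\<^sub>1"
  define d where "d = p\<^sub>1 - p\<^sub>0"
  define s where "s = (binary_entropy p\<^sub>1 - binary_entropy p\<^sub>0) / d"
  \<comment> \<open>\<open>r\<close> has log-odds \<open>- s\<close>: there the derivative of the
    binary entropy equals the slope \<open>s\<close> of the chord.\<close>
  define u where "u = 2 powr (- s)"
  define r where "r = u / (1 + u)"
  have p: "p\<^sub>0 \<in> {0..1}" "p\<^sub>1 \<in> {0..1}" "0 < d" "p\<^sub>1 = p\<^sub>0 + d"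
    using e lt by (auto simp: p\<^sub>0_def p\<^sub>1_def d_def)
  have u: "0 < u" and r: "0 < r" "r < 1"
    by (auto simp: u_def r_def field_simps add_pos_pos)
  have r1: "1 - r = 1 / (1 + u)" using u by (simp add: r_def field_simps)
  have logu: "log 2 u = - s" by (simp add: u_def)
  have logr: "log 2 r = - s - log 2 (1 + u)" "log 2 (1 - r) = - log 2 (1 + u)"
    using u logu unfolding r1 by (simp_all add: r_def log_divide)
  have H1: "binary_entropy p\<^sub>1 = binary_entropy p\<^sub>0 + s * d" using p by (simp add: s_def)
  \<comment> \<open>In terms of the output law \<open>q = p\<^sub>0 + t * d\<close>, the information
    is \<open>binary_entropy q - s * q\<close> plus a constant.\<close>
  have info: "binary_information p\<^sub>0 p\<^sub>1 t = binary_entropy (p\<^sub>0 + t * d) - s * (p\<^sub>0 + t * d) + (s * p\<^sub>0 - binary_entropy p\<^sub>0)" for t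
  proof -
    have "(1 - t) * p\<^sub>0 + t * p\<^sub>1 = p\<^sub>0 + t * d" by (simp add: p(4) algebra_simps)
    then show ?thesis by (simp add: binary_information_def H1 algebra_simps)
  qed
  have upper: "binary_entropy q - s * q \<le> log 2 (1 + u)" if "q \<in> {0..1}" for q
    using binary_entropy_le_cross_entropy[OF that r] by (simp add: logr algebra_simps)
  have attained: "binary_entropy r - s * r = log 2 (1 + u)"
    by (simp add: binary_entropy_def logr algebra_simps)
  \<comment> \<open>Log-odds are increasing, so positions relative to \<open>r\<close> can be
    compared through log-odds.\<close>
  have mono: "a \<le> b" if "a \<in> {0<..<1}" "b \<in> {0<..<1}" "log 2 a - log 2 (1 - a) \<le> log 2 b - log 2 (1 - b)" for a b :: real
  proof (rule ccontr)
    assume "\<not> a \<le> b"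
    then have "log 2 b < log 2 a" "log 2 (1 - a) < log 2 (1 - b)" using that(1,2) by simp_all
    then show False using that(3) by linarith
  qed
  \<comment> \<open>The tangent at \<open>p\<^sub>0\<close> lies above the graph at
    \<open>p\<^sub>1\<close>, so the chord is no steeper than this tangent and the log-odds of
    \<open>p\<^sub>0\<close> are at most \<open>- s\<close>. At \<open>p\<^sub>0 = 0\<close> there
    is no finite tangent. The bound \<open>r \<le> p\<^sub>1\<close> below is the mirror
    image.\<close>
  have "p\<^sub>0 \<le> r"
  proof (cases "p\<^sub>0 = 0")
    case False
    then have p0: "0 < p\<^sub>0" "p\<^sub>0 < 1" using p by auto
    have "d * (s + (log 2 p\<^sub>0 - log 2 (1 - p\<^sub>0))) \<le> 0"
      using binary_entropy_le_cross_entropy[OF p(2) p0] unfolding H1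
      by (simp add: binary_entropy_def p(4) algebra_simps)
    then have "s + (log 2 p\<^sub>0 - log 2 (1 - p\<^sub>0)) \<le> 0" using p(3) by (simp add: mult_le_0_iff)
    then have "log 2 p\<^sub>0 - log 2 (1 - p\<^sub>0) \<le> log 2 r - log 2 (1 - r)"
      unfolding logr by linarith
    then show ?thesis by (rule mono[rotated 2]) (use p0 r in simp_all)
  qed (use r in simp)
  have "r \<le> p\<^sub>1"
  proof (cases "p\<^sub>1 = 1")
    case False
    then have p1: "0 < p\<^sub>1" "p\<^sub>1 < 1" using p by auto
    have "0 \<le> binary_entropy p\<^sub>1 - s * d - binary_entropy p\<^sub>0" using H1 by simp
    then have "binary_entropy p\<^sub>0 = binary_entropy p\<^sub>1 - s * d" using H1 by simp
    then have "0 \<le> d * (s + (log 2 p\<^sub>1 - log 2 (1 - p\<^sub>1)))"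
      using binary_entropy_le_cross_entropy[OF p(1) p1]
      by (simp add: binary_entropy_def d_def algebra_simps)
    then have "0 \<le> s + (log 2 p\<^sub>1 - log 2 (1 - p\<^sub>1))" using p(3) by (simp add: zero_le_mult_iff)
    then have "log 2 r - log 2 (1 - r) \<le> log 2 p\<^sub>1 - log 2 (1 - p\<^sub>1)"
      unfolding logr by linarith
    then show ?thesis by (rule mono[rotated 2]) (use p1 r in simp_all)
  qed (use r in simp)
  let ?v = "log 2 (1 + u) + (s * p\<^sub>0 - binary_entropy p\<^sub>0)"
  have "(SUP t\<in>{0..1}. ereal (binary_information p\<^sub>0 p\<^sub>1 t)) = ereal ?v"
  proof (rule antisym[OF SUP_least])
    fix t :: real assume t: "t \<in> {0..1}"
    have "0 \<le> t * d" "t * d \<le> d" using t p by (simp_all add: mult_le_cancel_right1)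
    then have "p\<^sub>0 + t * d \<in> {0..1}" using p(1,2,4) unfolding atLeastAtMost_iff by linarith
    from upper[OF this] show "ereal (binary_information p\<^sub>0 p\<^sub>1 t) \<le> ereal ?v"
      by (simp add: info)
  next
    \<comment> \<open>The input weight whose output law is \<open>r\<close>.\<close>
    have "(r - p\<^sub>0) / d \<in> {0..1}" using \<open>p\<^sub>0 \<le> r\<close> \<open>r \<le> p\<^sub>1\<close> p by simp
    moreover have "binary_information p\<^sub>0 p\<^sub>1 ((r - p\<^sub>0) / d) = ?v"
    proof -
      have "p\<^sub>0 + (r - p\<^sub>0) / d * d = r" using p(3) by simp
      then show ?thesis using attained unfolding info by simp
    qed
    ultimately show "ereal ?v \<le> (SUP t\<in>{0..1}. ereal (binary_information p\<^sub>0 p\<^sub>1 t))"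
      by (metis SUP_upper)
  qed
  then have 1: "C_BAC \<epsilon>\<^sub>0 \<epsilon>\<^sub>1 = ereal ?v" using C_BAC_eq[OF e] by (simp add: p\<^sub>0_def p\<^sub>1_def)
  have H: "binary_entropy p\<^sub>1 = binary_entropy \<epsilon>\<^sub>1" by (simp add: p\<^sub>1_def binary_entropy_minus)
  have d: "1 - \<epsilon>\<^sub>0 - \<epsilon>\<^sub>1 = d" by (simp add: d_def p\<^sub>0_def p\<^sub>1_def)
  have u': "2 powr ((binary_entropy \<epsilon>\<^sub>0 - binary_entropy \<epsilon>\<^sub>1) / d) = u"
    by (simp add: u_def s_def H p\<^sub>0_def minus_divide_left)
  have "s * p\<^sub>0 - binary_entropy p\<^sub>0 = \<epsilon>\<^sub>0 / d * binary_entropy \<epsilon>\<^sub>1 - (\<epsilon>\<^sub>0 + d) / d * binary_entropy \<epsilon>\<^sub>0"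
    using p(3) by (simp add: s_def H p\<^sub>0_def field_simps)
  moreover have "\<epsilon>\<^sub>0 + d = 1 - \<epsilon>\<^sub>1" by (simp add: d_def p\<^sub>0_def p\<^sub>1_def)
  ultimately show ?thesis unfolding 1 d u' by simp
qed

subsection \<open>From mutual-information privacy to LDP\<close>

text \<open>Compactness turns the supremum into a maximum. The bound on the values is kept as well,
  since \<open>Sup\<close> on the reals is an upper bound only for sets bounded above.\<close>

lemma delta_LDP_in_values:
  assumes "0 \<le> \<mu>"
  shows "delta_LDP \<mu> \<epsilon> \<in> delta_LDP_values \<mu> \<epsilon>" and "bdd_above (delta_LDP_values \<mu> \<epsilon>)"
proof -
  let ?D = "{(p\<^sub>0, p\<^sub>1). p\<^sub>0 \<in> {0..1} \<and> p\<^sub>1 \<in> {0..1} \<and> C_BAC p\<^sub>0 (1 - p\<^sub>1) \<le> ereal \<mu>}"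
  let ?g = "\<lambda>z. max 0 (max (fst z - exp \<epsilon> * snd z) (snd z - exp \<epsilon> * fst z))"
  have vals: "delta_LDP_values \<mu> \<epsilon> = ?g ` ?D"
  proof (intro equalityI subsetI)
    fix v assume "v \<in> delta_LDP_values \<mu> \<epsilon>"
    then obtain p\<^sub>0 p\<^sub>1 where "v = ?g (p\<^sub>0, p\<^sub>1)" "(p\<^sub>0, p\<^sub>1) \<in> ?D"
      unfolding delta_LDP_values_def by auto
    then show "v \<in> ?g ` ?D" by (rule image_eqI)
  next
    fix v assume "v \<in> ?g ` ?D"
    then obtain p\<^sub>0 p\<^sub>1 where "v = ?g (p\<^sub>0, p\<^sub>1)" "(p\<^sub>0, p\<^sub>1) \<in> ?D" by blast
    then show "v \<in> delta_LDP_values \<mu> \<epsilon>"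
      unfolding delta_LDP_values_def by (intro CollectI exI[of _ p\<^sub>0] exI[of _ p\<^sub>1]) auto
  qed
  \<comment> \<open>A bound on a supremum is a bound for every \<open>t\<close>, so the sublevel set
    is an intersection of closed sets.\<close>
  have "?D = ({0..1} \<times> {0..1}) \<inter> (\<Inter>t\<in>{0..1}.
      {z \<in> {0..1} \<times> {0..1}. binary_information (fst z) (snd z) t \<le> \<mu>})"
    by (auto simp: C_BAC_eq SUP_le_iff)
  moreover have "closed {z \<in> {0..1} \<times> {0..1}. binary_information (fst z) (snd z) t \<le> \<mu>}"
    if t: "t \<in> {0..1}" for t
  proof (rule continuous_on_closed_Collect_le)
    have "(1 - t) * fst z + t * snd z \<in> {0..1}" if "z \<in> {0..1} \<times> {0..1}" for z
      using convexD_alt[of "{0..1::real}" "fst z" "snd z" t] that t by auto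
    then show "continuous_on ({0..1} \<times> {0..1}) (\<lambda>z. binary_information (fst z) (snd z) t)"
      unfolding binary_information_def
      by (intro continuous_intros continuous_on_compose2[OF continuous_on_binary_entropy]) auto
  qed (auto intro: closed_Times)
  ultimately have "compact ?D"
    by (auto intro!: compact_Int_closed compact_Times closed_INT)
  \<comment> \<open>The constant channel has capacity 0, so \<open>0 \<le> \<mu>\<close> makes the
    domain nonempty.\<close>
  moreover have "(0, 0) \<in> ?D" using C_BAC_zero[of 0] assms by simp
  moreover have "continuous_on ?D ?g" by (intro continuous_intros)
  ultimately obtain z where z: "z \<in> ?D" "\<forall>y\<in>?D. ?g y \<le> ?g z"
    using continuous_attains_sup[of ?D ?g] by blast
  then have "delta_LDP \<mu> \<epsilon> = ?g z"
    unfolding delta_LDP_def vals by (intro cSup_eq_maximum) auto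
  then show "delta_LDP \<mu> \<epsilon> \<in> delta_LDP_values \<mu> \<epsilon>" using z unfolding vals by blast
  show "bdd_above (delta_LDP_values \<mu> \<epsilon>)" unfolding vals by (rule bdd_aboveI2[of _ _ "?g z"]) (rule z(2)[rule_format])
qed

lemma delta_LDP_ge:
  assumes "0 \<le> \<mu>" "p\<^sub>0 \<in> {0..1}" "p\<^sub>1 \<in> {0..1}" "C_BAC p\<^sub>0 (1 - p\<^sub>1) \<le> ereal \<mu>"
  shows "p\<^sub>0 - exp \<epsilon> * p\<^sub>1 \<le> delta_LDP \<mu> \<epsilon>" "0 \<le> delta_LDP \<mu> \<epsilon>"
proof -
  have "Max {0, p\<^sub>0 - exp \<epsilon> * p\<^sub>1, p\<^sub>1 - exp \<epsilon> * p\<^sub>0} \<le> delta_LDP \<mu> \<epsilon>"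
    unfolding delta_LDP_def
    by (rule cSup_upper[OF _ delta_LDP_in_values(2)[OF assms(1)]]) (use assms in \<open>auto simp: delta_LDP_values_def\<close>)
  then show "p\<^sub>0 - exp \<epsilon> * p\<^sub>1 \<le> delta_LDP \<mu> \<epsilon>" "0 \<le> delta_LDP \<mu> \<epsilon>" by auto
qed

text \<open>Feeding a bit as \<open>x\<close> or \<open>x'\<close> into \<open>M\<close> and testing
  membership in \<open>E\<close> yields a binary channel of capacity at most \<open>\<mu>\<close>.
  The LDP inequality is then one of the differences in the definition of
  \<open>delta_LDP\<close>.\<close>

lemma CI_LMIP_imp_LDP:
  assumes sing: "\<forall>x\<in>space X. {x} \<in> sets X" and eps: "0 < \<epsilon>" and mu: "0 \<le> \<mu>" and M: "mechanism X Y M"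
    and ci: "CI_LMIP X Y (distributions X) (ereal \<mu>) M"
  shows "LDP X Y \<epsilon> (delta_LDP \<mu> \<epsilon>) M"
  unfolding LDP_def
proof (intro ballI)
  fix x x' E assume x: "x \<in> space X" "x' \<in> space X" and E[measurable]: "E \<in> sets Y"
  show "measure (M x) E \<le> exp \<epsilon> * measure (M x') E + delta_LDP \<mu> \<epsilon>"
  proof (cases "x = x'")
    case True
    \<comment> \<open>Equal points give no two-input channel; here
      \<open>1 \<le> exp \<epsilon>\<close> and a nonnegative \<open>delta_LDP\<close>
      suffice.\<close>
    have "0 \<le> delta_LDP \<mu> \<epsilon>"
      using delta_LDP_ge(2)[OF mu, of 0 0] C_BAC_zero[of 0] mu by simp
    moreover have "1 * measure (M x) E \<le> exp \<epsilon> * measure (M x) E"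
      using eps by (intro mult_right_mono) auto
    ultimately show ?thesis using True by simp
  next
    case False
    note pr = mechanismD[OF M]
    define p where "p b = measure (M (if b then x' else x)) E" for b
    have p: "p b \<in> {0..1}" for b
      using prob_space.prob_le_1[OF pr(1)] x by (auto simp: p_def)
    let ?U = "count_space UNIV :: bool measure"
    have bac: "bac (p False) (1 - p True) b = distr (M (if b then x' else x)) ?U (\<lambda>y. y \<in> E)" for b
    proof (rule measure_eqI)
      interpret prob_space "M (if b then x' else x)" using pr x by auto
      have [measurable_cong]: "sets (M (if b then x' else x)) = sets Y" using pr x by auto
      have pb: "bac (p False) (1 - p True) b = measure_pmf (bernoulli_pmf (p b))"
        by (simp add: bac_def)
      show "sets (bac (p False) (1 - p True) b) = sets (distr (M (if b then x' else x)) ?U (\<lambda>y. y \<in> E))"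
        by (simp add: pb)
      fix A :: "bool set"
      have "emeasure (distr (M (if b then x' else x)) ?U (\<lambda>y. y \<in> E)) A = ennreal (indicator A True * p b + indicator A False * (1 - p b))"
      proof -
        have "emeasure (distr (M (if b then x' else x)) ?U (\<lambda>y. y \<in> E)) A =
            (\<integral>\<^sup>+y. indicator A (y \<in> E) \<partial>M (if b then x' else x))"
          by (subst nn_integral_distr[symmetric, where M'="?U"]) auto
        also have "\<dots> = (\<integral>\<^sup>+y. indicator A True * indicator E y + indicator A False * indicator (space Y - E) y
            \<partial>M (if b then x' else x))"
          using pr(3) x by (intro nn_integral_cong) (auto simp: indicator_def)
        also have "\<dots> = indicator A True * emeasure (M (if b then x' else x)) E +
            indicator A False * emeasure (M (if b then x' else x)) (space Y - E)"
          by (simp add: nn_integral_add nn_integral_cmult)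
        also have "emeasure (M (if b then x' else x)) E = ennreal (p b)"
          by (simp add: emeasure_eq_measure p_def)
        also have "emeasure (M (if b then x' else x)) (space Y - E) = ennreal (1 - p b)"
          using prob_compl[of E] pr(3) pr(2) x E
          by (simp add: emeasure_eq_measure p_def)
        also have "indicator A True * ennreal (p b) + indicator A False * ennreal (1 - p b) =
            ennreal (indicator A True * p b + indicator A False * (1 - p b))"
          using p[of b] by (auto simp: indicator_def simp flip: ennreal_plus)
        finally show ?thesis .
      qed
      then show "emeasure (bac (p False) (1 - p True) b) A = emeasure (distr (M (if b then x' else x)) ?U (\<lambda>y. y \<in> E)) A"
        unfolding pb using p[of b] by (subst emeasure_bernoulli) auto
    qed
    have "C_BAC (p False) (1 - p True) \<le> ereal \<mu>"
      unfolding C_BAC_def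
    proof (rule SUP_least)
      fix P assume P: "P \<in> distributions ?U"
      have "mechanism ?U ?U (bac (p False) (1 - p True))"
        using mechanism_bernoulli[of "\<lambda>b. if b then p True else p False" ?U] p
        by (simp add: bac_def[abs_def] if_distrib cong: if_cong)
      \<comment> \<open>The explicit two-level formula is real-valued, which supplies the finiteness
        premise of data processing.\<close>
      moreover have "channel_information ?U ?U P (bac (p False) (1 - p True)) \<noteq> \<infinity>"
        using channel_information_two_level[OF P, of "{True}" "p False" "p True"] p
        by (simp add: bac_def[abs_def] if_distrib cong: if_cong)
      ultimately have "channel_information ?U ?U P (bac (p False) (1 - p True)) \<le>
          channel_information X Y (distr P X (\<lambda>b. if b then x' else x)) M"
      proof (intro channel_information_data_processing[OF P M, where f="\<lambda>y. y = x'" and h="\<lambda>y. y \<in> E"])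
        \<comment> \<open>The test for equality with \<open>x'\<close> recovers the input bit, and
          it is measurable because singletons are.\<close>
        have "{x'} \<in> sets X" using sing x by blast
        then show "(\<lambda>y. y = x') \<in> X \<rightarrow>\<^sub>M ?U"
          by measurable
      qed (use x False bac in auto)
      also have "\<dots> \<le> ereal \<mu>"
      proof (rule order_trans[OF SUP_upper ci[unfolded CI_LMIP_def]])
        have "(\<lambda>b. if b then x' else x) \<in> P \<rightarrow>\<^sub>M X"
          using x P by (subst measurable_cong_sets[of P ?U X X]) (auto simp: space_prob_algebra)
        then show "distr P X (\<lambda>b. if b then x' else x) \<in> distributions X"
          using P prob_space.prob_space_distr by (auto simp: space_prob_algebra)
      qed
      finally show "channel_information ?U ?U P (bac (p False) (1 - p True)) \<le> ereal \<mu>" .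
    qed
    from delta_LDP_ge(1)[OF mu p p this, of \<epsilon>] show ?thesis by (simp add: p_def)
  qed
qed

text \<open>Because the maximum is attained at some pair, one mechanism built from that pair defeats
  every smaller \<open>\<delta>\<close> at once. Its information at \<open>P\<close> is that of the
  binary channel with input weight \<open>measure P {x\<^sub>1}\<close>.\<close>

lemma LDP_tight:
  assumes x: "x\<^sub>0 \<in> space X" "x\<^sub>1 \<in> space X" "x\<^sub>0 \<noteq> x\<^sub>1" and A: "{x\<^sub>1} \<in> sets X" and mu: "0 \<le> \<mu>"
  shows "\<exists>(Y :: bool measure) M. mechanism X Y M \<and> CI_LMIP X Y (distributions X) (ereal \<mu>) M \<and>
    (\<forall>\<delta> < delta_LDP \<mu> \<epsilon>. \<not> LDP X Y \<epsilon> \<delta> M)"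
proof -
  obtain p\<^sub>0 p\<^sub>1 where p: "p\<^sub>0 \<in> {0..1}" "p\<^sub>1 \<in> {0..1}" "C_BAC p\<^sub>0 (1 - p\<^sub>1) \<le> ereal \<mu>"
    and d: "delta_LDP \<mu> \<epsilon> = Max {0, p\<^sub>0 - exp \<epsilon> * p\<^sub>1, p\<^sub>1 - exp \<epsilon> * p\<^sub>0}"
    using delta_LDP_in_values(1)[OF mu, of \<epsilon>] unfolding delta_LDP_values_def by blast
  let ?U = "count_space UNIV :: bool measure"
  let ?M = "\<lambda>x. measure_pmf (bernoulli_pmf (if x \<in> {x\<^sub>1} then p\<^sub>1 else p\<^sub>0))"
  have mech: "mechanism X ?U ?M"
  proof (rule mechanism_bernoulli)
    show "(\<lambda>x. if x \<in> {x\<^sub>1} then p\<^sub>1 else p\<^sub>0) \<in> borel_measurable X"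
      using A by (intro measurable_If_set) (auto simp: sets.Int_space_eq2)
  qed (use p in auto)
  have "channel_information X ?U P ?M \<le> ereal \<mu>" if P: "P \<in> distributions X" for P
  proof -
    have "measure P {x\<^sub>1} \<in> {0..1}" using P prob_space.prob_le_1 by (auto simp: space_prob_algebra)
    then have "ereal (binary_information p\<^sub>0 p\<^sub>1 (measure P {x\<^sub>1})) \<le> C_BAC p\<^sub>0 (1 - p\<^sub>1)"
      using p by (subst C_BAC_eq) (auto intro: SUP_upper)
    also note p(3)
    finally show ?thesis unfolding channel_information_two_level[OF P A p(1,2)] .
  qed
  then have ci: "CI_LMIP X ?U (distributions X) (ereal \<mu>) ?M"
    unfolding CI_LMIP_def by (intro SUP_least)
  have "\<not> LDP X ?U \<epsilon> \<delta> ?M" if less: "\<delta> < delta_LDP \<mu> \<epsilon>" for \<delta>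
  proof
    assume ldp: "LDP X ?U \<epsilon> \<delta> ?M"
    \<comment> \<open>The empty event accounts for the entry 0 of the \<open>Max\<close>; the event
      \<open>{True}\<close>, with the points in both orders, accounts for the two
      differences.\<close>
    have "0 \<le> \<delta>"
      using ldp[unfolded LDP_def, rule_format, of x\<^sub>0 x\<^sub>0 "{}"] x by simp
    moreover have "p\<^sub>0 \<le> exp \<epsilon> * p\<^sub>1 + \<delta>" "p\<^sub>1 \<le> exp \<epsilon> * p\<^sub>0 + \<delta>"
      using ldp[unfolded LDP_def, rule_format, of x\<^sub>0 x\<^sub>1 "{True}"]
        ldp[unfolded LDP_def, rule_format, of x\<^sub>1 x\<^sub>0 "{True}"] x p
      by (auto simp: measure_pmf_single)
    ultimately show False using less unfolding d by auto
  qed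
  with mech ci show ?thesis by blast
qed

subsection \<open>From LDP to mutual-information privacy\<close>

text \<open>One positive part suffices in each case: \<open>f - exp t\<close> up to
  \<open>ln f\<close> if \<open>1 < f\<close>, and \<open>exp (- t) - f\<close> up to
  \<open>- ln f\<close> if \<open>0 < f \<le> 1\<close>, or up to infinity if \<open>f = 0\<close>.
  Each has an explicit antiderivative.\<close>

lemma relative_entropy_integrand_le:
  fixes f :: real
  assumes "0 \<le> f"
  shows "ennreal (f * ln f - f + 1) \<le>
    (\<integral>\<^sup>+t\<in>{0<..}. (ennreal (max 0 (f - exp t)) + ennreal (exp (- t)) * ennreal (max 0 (1 - exp t * f))) \<partial>lborel)"
    (is "_ \<le> (\<integral>\<^sup>+t\<in>{0<..}. ?h t \<partial>lborel)")
proof -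
  have le: "(\<integral>\<^sup>+t. ennreal (g t) * indicator A t \<partial>lborel) \<le> (\<integral>\<^sup>+t\<in>{0<..}. ?h t \<partial>lborel)"
    if "\<And>t. t \<in> A \<Longrightarrow> 0 < t \<Longrightarrow> ennreal (g t) \<le> ?h t" "A \<subseteq> {0..}" for g A
  proof (rule nn_integral_mono_AE)
    \<comment> \<open>The integration ranges used below contain 0, whereas the target range is open
      at 0; this point is null.\<close>
    have "AE t in lborel. t \<noteq> (0::real)" by (rule AE_lborel_singleton)
    then show "AE t in lborel. ennreal (g t) * indicator A t \<le> ?h t * indicator {0<..} t"
    proof eventually_elim
      fix t :: real assume t: "t \<noteq> 0"
      show "ennreal (g t) * indicator A t \<le> ?h t * indicator {0<..} t"
      proof (cases "t \<in> A")
        case True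
        then have "0 < t" using that(2) t by force
        with that(1)[OF True] True show ?thesis by simp
      qed simp
    qed
  qed
  have h2: "ennreal (exp (- t) - f) \<le> ?h t" if "0 < t" for t
  proof -
    have "ennreal (exp (- t) - f) = ennreal (exp (- t) * (1 - exp t * f))"
      by (simp add: algebra_simps exp_minus)
    also have "\<dots> \<le> ennreal (exp (- t) * max 0 (1 - exp t * f))"
      by (intro ennreal_leI mult_left_mono) auto
    also have "\<dots> = ennreal (exp (- t)) * ennreal (max 0 (1 - exp t * f))"
      by (rule ennreal_mult) auto
    finally show ?thesis by (rule order_trans) simp
  qed
  consider "f = 0" | "0 < f" "f \<le> 1" | "1 < f" using assms by linarith
  then show ?thesis
  proof cases
    case 1
    have "((\<lambda>t. - exp (- t)) \<longlongrightarrow> (- 0 :: real)) at_top"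
      by (intro tendsto_intros filterlim_compose[OF exp_at_bot] filterlim_uminus_at_bot_at_top)
    then have "(\<integral>\<^sup>+t. ennreal (exp (- t)) * indicator {0..} t \<partial>lborel) = ennreal (- 0 - - exp (- 0))"
      by (intro nn_integral_FTC_atLeast) (auto intro!: derivative_eq_intros)
    moreover have "(\<integral>\<^sup>+t. ennreal (exp (- t)) * indicator {0..} t \<partial>lborel) \<le> (\<integral>\<^sup>+t\<in>{0<..}. ?h t \<partial>lborel)"
      using h2 1 by (intro le) auto
    ultimately show ?thesis using 1 by simp
  next
    case 2
    have "exp (- t) - f \<ge> 0" if "t \<le> - ln f" for t
      using that 2 by (metis diff_ge_0_iff_ge exp_le_cancel_iff exp_ln le_minus_iff)
    then have "(\<integral>\<^sup>+t. ennreal (exp (- t) - f) * indicator {0..- ln f} t \<partial>lborel) =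
        ennreal ((- exp (- (- ln f)) - f * (- ln f)) - (- exp (- 0) - f * 0))"
      using 2 by (intro nn_integral_FTC_Icc) (auto intro!: derivative_eq_intros)
    also have "(- exp (- (- ln f)) - f * (- ln f)) - (- exp (- 0) - f * 0) = f * ln f - f + 1"
      using 2 by simp
    finally show ?thesis
      using le[of "{0..- ln f}" "\<lambda>t. exp (- t) - f"] h2 by auto
  next
    case 3
    have "f - exp t \<ge> 0" if "t \<le> ln f" for t
      using that 3 by (metis diff_ge_0_iff_ge exp_le_cancel_iff exp_ln less_trans zero_less_one)
    then have "(\<integral>\<^sup>+t. ennreal (f - exp t) * indicator {0..ln f} t \<partial>lborel) =
        ennreal ((f * ln f - exp (ln f)) - (f * 0 - exp 0))"
      using 3 by (intro nn_integral_FTC_Icc) (auto intro!: derivative_eq_intros)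
    also have "(f * ln f - exp (ln f)) - (f * 0 - exp 0) = f * ln f - f + 1"
      using 3 by simp
    finally show ?thesis
      using le[of "{0..ln f}" "\<lambda>t. f - exp t"] by (auto simp: add_increasing2 ennreal_leI)
  qed
qed

lemma emeasure_lborel_greaterThan: "emeasure lborel {0::real<..} = \<infinity>"
proof (rule ccontr)
  assume "emeasure lborel {0::real<..} \<noteq> \<infinity>"
  then obtain n where n: "emeasure lborel {0::real<..} < of_nat n"
    using ennreal_Ex_less_of_nat by (auto simp: less_top)
  have "ennreal (real n) \<le> emeasure lborel {0::real<..}"
    using emeasure_mono[of "{0<..<real n}" "{0::real<..}" lborel] by (simp add: subset_iff)
  with n show False by (simp add: ennreal_of_nat_eq_real_of_nat)
qed

text \<open>Stated for any two probability measures that are indistinguishable in both directions up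
  to \<open>exp t\<close> and \<open>\<delta> t\<close>. A divergent integral makes the bound
  trivial; a convergent one forces absolute continuity, so that a density exists.\<close>

lemma kl_bits_le_mu_CI:
  assumes Q: "prob_space Q" and N: "prob_space N" and sets: "sets N = sets Q"
    and dm: "\<delta> \<in> borel_measurable (restrict_space borel {0<..})"
    and d0: "\<And>t. 0 < t \<Longrightarrow> 0 \<le> \<delta> t"
    and NQ: "\<And>t S. 0 < t \<Longrightarrow> S \<in> sets Q \<Longrightarrow>
      emeasure N S \<le> ennreal (exp t) * emeasure Q S + ennreal (\<delta> t)"
    and QN: "\<And>t S. 0 < t \<Longrightarrow> S \<in> sets Q \<Longrightarrow>
      emeasure Q S \<le> ennreal (exp t) * emeasure N S + ennreal (\<delta> t)"
  shows "kl_bits Q N \<le> mu_CI \<delta>"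
proof -
  let ?I = "\<integral>\<^sup>+t\<in>{0<..}. ennreal ((1 + exp (- t)) * \<delta> t) \<partial>lborel"
  have c0: "0 < log 2 (exp 1 :: real)" by simp
  show ?thesis
  proof (cases "?I = \<infinity>")
    case True
    then show ?thesis using c0 by (simp add: mu_CI_def)
  next
    case fin: False
    interpret Q: prob_space Q by fact
    interpret N: prob_space N by fact
    \<comment> \<open>A positive lower bound on \<open>\<delta>\<close> would make the integral over
      the infinite half-line diverge. Small values of \<open>\<delta>\<close> then force
      \<open>N\<close> to vanish on null sets of \<open>Q\<close>.\<close>
    have small: "\<exists>t>0. \<delta> t < \<eta>" if "0 < \<eta>" for \<eta>
    proof (rule ccontr)
      assume "\<not> ?thesis"
      then have ge: "\<eta> \<le> \<delta> t" if "0 < t" for t using that by force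
      have "\<infinity> = ennreal \<eta> * emeasure lborel {0::real<..}"
        using \<open>0 < \<eta>\<close> by (simp add: emeasure_lborel_greaterThan ennreal_mult_top)
      also have "\<dots> = (\<integral>\<^sup>+t\<in>{0::real<..}. ennreal \<eta> \<partial>lborel)"
        by (rule nn_integral_cmult_indicator[symmetric]) simp
      also have "\<dots> \<le> ?I"
      proof (rule nn_integral_mono)
        fix t :: real
        have "\<eta> \<le> (1 + exp (- t)) * \<delta> t" if "0 < t"
        proof -
          have "\<delta> t \<le> (1 + exp (- t)) * \<delta> t" using d0[OF that] by (simp add: distrib_right)
          with ge[OF that] show ?thesis by linarith
        qed
        then show "ennreal \<eta> * indicator {0<..} t \<le> ennreal ((1 + exp (- t)) * \<delta> t) * indicator {0<..} t"
          by (auto simp: indicator_def intro: ennreal_leI)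
      qed
      finally show False using fin by (simp add: top_unique)
    qed
    have ac: "absolutely_continuous Q N"
      unfolding absolutely_continuous_def
    proof
      fix S assume S: "S \<in> null_sets Q"
      then have S': "S \<in> sets Q" "emeasure Q S = 0" by auto
      have "emeasure N S = 0"
      proof (rule ccontr)
        assume "emeasure N S \<noteq> 0"
        then have "0 < measure N S" by (simp add: N.emeasure_eq_measure less_le)
        from small[OF this] obtain t where "0 < t" "\<delta> t < measure N S" by blast
        with NQ[OF \<open>0 < t\<close> S'(1)] S'(2) show False
          by (auto simp: N.emeasure_eq_measure d0)
      qed
      then show "S \<in> null_sets N" using S' sets by auto
    qed
    obtain F :: "'a \<Rightarrow> real" where F[measurable]: "F \<in> borel_measurable Q" and F0: "\<And>x. 0 \<le> F x"
      and NF: "N = density Q F"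
      by (rule real_density_exists[OF Q N ac sets]) (rule that)
    have emN: "emeasure N S = (\<integral>\<^sup>+z\<in>S. ennreal (F z) \<partial>Q)" if "S \<in> sets Q" for S
      unfolding NF using that by (intro emeasure_density) auto
    \<comment> \<open>The positive part is the excess of \<open>N\<close> over \<open>exp t\<close>
      times \<open>Q\<close> on the set where it is positive; \<open>NQ\<close> is applied to this
      set and the finite common term is cancelled. \<open>E2\<close> exchanges the roles of
      \<open>Q\<close> and \<open>N\<close>.\<close>
    have E1: "(\<integral>\<^sup>+z. ennreal (max 0 (F z - exp t)) \<partial>Q) \<le> ennreal (\<delta> t)" if t: "0 < t" for t
    proof -
      let ?S = "{z \<in> space Q. exp t < F z}"
      have S[measurable]: "?S \<in> sets Q" by measurable
      have "ennreal (exp t) * emeasure Q ?S + (\<integral>\<^sup>+z. ennreal (max 0 (F z - exp t)) \<partial>Q) =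
          (\<integral>\<^sup>+z. ennreal (exp t) * indicator ?S z + ennreal (max 0 (F z - exp t)) \<partial>Q)"
        by (subst nn_integral_add) (auto simp: nn_integral_cmult_indicator)
      also have "\<dots> = (\<integral>\<^sup>+z\<in>?S. ennreal (F z) \<partial>Q)"
        by (intro nn_integral_cong) (auto simp: indicator_def max_def simp flip: ennreal_plus)
      also have "\<dots> \<le> ennreal (exp t) * emeasure Q ?S + ennreal (\<delta> t)"
        using NQ[OF t S] by (simp add: emN)
      finally show ?thesis
        by (subst (asm) ennreal_add_left_cancel_le) (auto simp: ennreal_mult_eq_top_iff)
    qed
    have E2: "(\<integral>\<^sup>+z. ennreal (max 0 (1 - exp t * F z)) \<partial>Q) \<le> ennreal (\<delta> t)" if t: "0 < t" for t
    proof -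
      let ?S = "{z \<in> space Q. exp t * F z < 1}"
      have S[measurable]: "?S \<in> sets Q" by measurable
      have "ennreal (exp t) * emeasure N ?S + (\<integral>\<^sup>+z. ennreal (max 0 (1 - exp t * F z)) \<partial>Q) =
          (\<integral>\<^sup>+z. ennreal (exp t) * (ennreal (F z) * indicator ?S z) + ennreal (max 0 (1 - exp t * F z)) \<partial>Q)"
        by (subst nn_integral_add) (auto simp: nn_integral_cmult emN)
      also have "\<dots> = (\<integral>\<^sup>+z. indicator ?S z \<partial>Q)"
        using F0 by (intro nn_integral_cong)
          (auto simp: indicator_def max_def simp flip: ennreal_plus ennreal_mult ennreal_1)
      also have "\<dots> \<le> ennreal (exp t) * emeasure N ?S + ennreal (\<delta> t)"
        using QN[OF t S] by simp
      finally show ?thesis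
        by (subst (asm) ennreal_add_left_cancel_le) (auto simp: ennreal_mult_eq_top_iff)
    qed
    let ?h = "\<lambda>z t. ennreal (max 0 (F z - exp t)) + ennreal (exp (- t)) * ennreal (max 0 (1 - exp t * F z))"
    \<comment> \<open>The added \<open>1 - F z\<close> integrates to 0 and makes the integrand
      nonnegative, so Tonelli applies before integrability is known.\<close>
    let ?\<phi> = "\<lambda>z. F z * ln (F z) - F z + 1"
    have \<phi>0: "0 \<le> ?\<phi> z" for z
    proof (cases "F z = 0")
      case False
      then have "0 < F z" using F0[of z] by linarith
      moreover from this have "ln (1 / F z) \<le> 1 / F z - 1" by (intro ln_le_minus_one) auto
      ultimately have "F z * (1 - 1 / F z) \<le> F z * ln (F z)"
        by (intro mult_left_mono) (auto simp: ln_div)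
      with \<open>0 < F z\<close> show ?thesis by (simp add: algebra_simps)
    qed simp
    interpret QL: pair_sigma_finite Q lborel ..
    have "(\<integral>\<^sup>+z. ennreal (?\<phi> z) \<partial>Q) \<le> (\<integral>\<^sup>+z. (\<integral>\<^sup>+t. ?h z t * indicator {0<..} t \<partial>lborel) \<partial>Q)"
      by (intro nn_integral_mono relative_entropy_integrand_le F0)
    also have "\<dots> = (\<integral>\<^sup>+t. \<integral>\<^sup>+z. ?h z t * indicator {0<..} t \<partial>Q \<partial>lborel)"
      by (rule QL.Fubini'[symmetric]) measurable
    also have "\<dots> \<le> ?I"
    proof (rule nn_integral_mono)
      fix t :: real
      show "(\<integral>\<^sup>+z. ?h z t * indicator {0<..} t \<partial>Q) \<le> ennreal ((1 + exp (- t)) * \<delta> t) * indicator {0<..} t"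
      proof (cases "0 < t")
        case True
        then have "(\<integral>\<^sup>+z. ?h z t * indicator {0<..} t \<partial>Q) =
            (\<integral>\<^sup>+z. ennreal (max 0 (F z - exp t)) \<partial>Q) +
            ennreal (exp (- t)) * (\<integral>\<^sup>+z. ennreal (max 0 (1 - exp t * F z)) \<partial>Q)"
          by (simp add: nn_integral_add nn_integral_cmult)
        also have "\<dots> \<le> ennreal (\<delta> t) + ennreal (exp (- t)) * ennreal (\<delta> t)"
          by (intro add_mono mult_left_mono E1 E2 True) auto
        also have "\<dots> = ennreal ((1 + exp (- t)) * \<delta> t)"
          using d0[OF True] by (simp add: distrib_right ennreal_plus ennreal_mult)
        finally show ?thesis using True by simp
      qed simp
    qed
    finally have \<phi>I: "(\<integral>\<^sup>+z. ennreal (?\<phi> z) \<partial>Q) \<le> ?I" .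
    then have "(\<integral>\<^sup>+z. ennreal (?\<phi> z) \<partial>Q) < \<infinity>" using fin by (simp add: less_top order_le_less_trans)
    then have int\<phi>: "integrable Q ?\<phi>"
      using \<phi>0 by (intro integrableI_nonneg) auto
    have F1: "(\<integral>\<^sup>+z. ennreal (F z) \<partial>Q) = 1"
      using N.emeasure_space_1 emN[of "space Q"] sets_eq_imp_space_eq[OF sets]
      by (simp cong: nn_integral_cong)
    then have intF: "integrable Q F" using F0 by (intro integrableI_nonneg) auto
    have F1': "(\<integral>z. F z \<partial>Q) = 1"
      using F1 F0 by (simp add: integral_eq_nn_integral)
    \<comment> \<open>Integrability of \<open>F z * ln (F z)\<close> is recovered from that of
      \<open>?\<phi>\<close> and \<open>F\<close>, which shows that the divergence is
      finite.\<close>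
    have "integrable Q (\<lambda>z. ?\<phi> z + F z - 1)" 
      by (rule Bochner_Integration.integrable_diff[OF Bochner_Integration.integrable_add[OF int\<phi> intF]]) simp
    then have intL: "integrable Q (\<lambda>z. F z * ln (F z))" by simp
    have eq: "F z * log 2 (F z) = log 2 (exp 1) * (F z * ln (F z))" for z
      by (simp add: log_def)
    have "(\<integral>z. ?\<phi> z \<partial>Q) = (\<integral>z. F z * ln (F z) \<partial>Q)"
      using intL intF F1' by (simp add: Q.prob_space)
    then have val: "(\<integral>z. F z * log 2 (F z) \<partial>Q) = log 2 (exp 1) * (\<integral>z. ?\<phi> z \<partial>Q)"
      unfolding eq by simp
    have "ennreal (\<integral>z. ?\<phi> z \<partial>Q) \<le> ?I"
      using \<phi>I nn_integral_eq_integral[OF int\<phi>] \<phi>0 by simp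
    then have "ereal (\<integral>z. ?\<phi> z \<partial>Q) \<le> enn2ereal ?I"
      using \<phi>0 by (simp add: less_eq_ennreal.rep_eq enn2ereal_ennreal integral_nonneg_AE)
    then have "ereal (log 2 (exp 1)) * ereal (\<integral>z. ?\<phi> z \<partial>Q) \<le> mu_CI \<delta>"
      unfolding mu_CI_def using c0 by (intro ereal_mult_left_mono) auto
    moreover have "kl_bits Q N = ereal (\<integral>z. F z * log 2 (F z) \<partial>Q)"
      unfolding NF using intL by (subst kl_bits_density[OF Q F F0]) (simp add: eq)
    ultimately show ?thesis by (simp add: val)
  qed
qed

text \<open>LDP is averaged twice: over one of the two inputs, to compare \<open>M x\<close> with
  the output law, and then over \<open>x\<close> along sections, to compare the joint law with the
  product of the marginals. As \<open>P\<close> has mass 1, \<open>\<delta> t\<close> survives both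
  averages unchanged.\<close>

lemma CI_LMIP_mu_CI:
  assumes M: "mechanism X Y M"
    and dm: "\<delta> \<in> borel_measurable (restrict_space borel {0<..})"
    and d0: "\<And>t. 0 < t \<Longrightarrow> 0 \<le> \<delta> t"
    and ldp: "\<And>t. 0 < t \<Longrightarrow> LDP X Y t (\<delta> t) M"
  shows "CI_LMIP X Y (distributions X) (mu_CI \<delta>) M"
  unfolding CI_LMIP_def
proof (rule SUP_least)
  fix P assume P: "P \<in> distributions X"
  interpret P: prob_space P using distributionsD[OF P] by simp
  interpret B: prob_space "P \<bind> M" using output_law_in[OF P M] by (simp add: space_prob_algebra)
  interpret PB: pair_prob_space P "P \<bind> M" ..
  have Bs: "sets (P \<bind> M) = sets Y" using output_law_in[OF P M] by (simp add: space_prob_algebra)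
  have Ps: "space P = space X" "sets P = sets X" using distributionsD[OF P] by auto
  have sP: "sets (P \<Otimes>\<^sub>M (P \<bind> M)) = sets (X \<Otimes>\<^sub>M Y)"
    by (rule sets_pair_measure_cong) (simp_all add: Ps Bs)
  have em: "(\<lambda>x. emeasure (M x) E) \<in> borel_measurable P" if "E \<in> sets Y" for E
    using measurable_emeasure_kernel[OF measurable_prob_algebraD[OF measurable_mechanism[OF P M]] that] .
  have pt: "emeasure (M x) E \<le> ennreal (exp t) * emeasure (M x') E + ennreal (\<delta> t)"
    if "x \<in> space X" "x' \<in> space X" "E \<in> sets Y" "0 < t" for x x' E t
  proof -
    interpret Mx: prob_space "M x" by (rule mechanismD[OF M that(1)])
    interpret Mx': prob_space "M x'" by (rule mechanismD[OF M that(2)])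
    show ?thesis using ldp[OF that(4)] that d0[OF that(4)]
      by (auto simp: LDP_def Mx.emeasure_eq_measure Mx'.emeasure_eq_measure simp flip: ennreal_mult ennreal_plus)
  qed
  have out1: "emeasure (M x) E \<le> ennreal (exp t) * emeasure (P \<bind> M) E + ennreal (\<delta> t)"
    if "x \<in> space X" "E \<in> sets Y" "0 < t" for x E t
  proof -
    have "emeasure (M x) E = (\<integral>\<^sup>+x'. emeasure (M x) E \<partial>P)" by (simp add: P.emeasure_space_1)
    also have "\<dots> \<le> (\<integral>\<^sup>+x'. ennreal (exp t) * emeasure (M x') E + ennreal (\<delta> t) \<partial>P)"
      using that Ps by (intro nn_integral_mono pt) auto
    also have "\<dots> = ennreal (exp t) * emeasure (P \<bind> M) E + ennreal (\<delta> t)"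
      using em[OF that(2)] by (simp add: nn_integral_add nn_integral_cmult P.emeasure_space_1 emeasure_output[OF P M that(2)])
    finally show ?thesis .
  qed
  have out2: "emeasure (P \<bind> M) E \<le> ennreal (exp t) * emeasure (M x) E + ennreal (\<delta> t)"
    if "x \<in> space X" "E \<in> sets Y" "0 < t" for x E t
  proof -
    have "emeasure (P \<bind> M) E = (\<integral>\<^sup>+x'. emeasure (M x') E \<partial>P)" by (rule emeasure_output[OF P M that(2)])
    also have "\<dots> \<le> (\<integral>\<^sup>+x'. ennreal (exp t) * emeasure (M x) E + ennreal (\<delta> t) \<partial>P)"
      using that Ps by (intro nn_integral_mono pt) auto
    finally show ?thesis by (simp add: P.emeasure_space_1)
  qed
  have joint: "emeasure (joint_law X Y P M) S = (\<integral>\<^sup>+x. emeasure (M x) (Pair x -` S) \<partial>P)"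
    "emeasure (P \<Otimes>\<^sub>M (P \<bind> M)) S = (\<integral>\<^sup>+x. emeasure (P \<bind> M) (Pair x -` S) \<partial>P)"
    "(\<lambda>x. emeasure (M x) (Pair x -` S)) \<in> borel_measurable P"
    "(\<lambda>x. emeasure (P \<bind> M) (Pair x -` S)) \<in> borel_measurable P"
    "\<And>x. Pair x -` S \<in> sets Y"
    if S: "S \<in> sets (P \<Otimes>\<^sub>M (P \<bind> M))" for S
  proof -
    have S': "S \<in> sets (X \<Otimes>\<^sub>M Y)" using S sP by simp
    show "emeasure (joint_law X Y P M) S = (\<integral>\<^sup>+x. emeasure (M x) (Pair x -` S) \<partial>P)"
      by (rule emeasure_joint_law[OF P M S'])
    show "(\<lambda>x. emeasure (M x) (Pair x -` S)) \<in> borel_measurable P"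
      by (rule measurable_emeasure_sections[OF P M S'])
    show "Pair x -` S \<in> sets Y" for x by (rule sets_Pair1[OF S'])
  qed (rule B.emeasure_pair_measure_alt[OF S] B.measurable_emeasure_Pair[OF S])+
  have "kl_bits (P \<Otimes>\<^sub>M (P \<bind> M)) (joint_law X Y P M) \<le> mu_CI \<delta>"
  proof (rule kl_bits_le_mu_CI)
    show "sets (joint_law X Y P M) = sets (P \<Otimes>\<^sub>M (P \<bind> M))"
      by (simp only: sP sets_joint_law[OF P M])
    show "prob_space (joint_law X Y P M)" by (rule prob_space_joint_law[OF P M])
    show "prob_space (P \<Otimes>\<^sub>M (P \<bind> M))" by (rule PB.prob_space_axioms)
    fix t :: real and S assume t: "0 < t" and S: "S \<in> sets (P \<Otimes>\<^sub>M (P \<bind> M))"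
    note j = joint[OF S]
    have "emeasure (joint_law X Y P M) S \<le>
        (\<integral>\<^sup>+x. ennreal (exp t) * emeasure (P \<bind> M) (Pair x -` S) + ennreal (\<delta> t) \<partial>P)"
      unfolding j(1) using Ps by (intro nn_integral_mono out1 j t) auto
    also have "\<dots> = ennreal (exp t) * emeasure (P \<Otimes>\<^sub>M (P \<bind> M)) S + ennreal (\<delta> t)"
      using j by (simp add: nn_integral_add nn_integral_cmult P.emeasure_space_1)
    finally show "emeasure (joint_law X Y P M) S \<le>
        ennreal (exp t) * emeasure (P \<Otimes>\<^sub>M (P \<bind> M)) S + ennreal (\<delta> t)" .
    have "emeasure (P \<Otimes>\<^sub>M (P \<bind> M)) S \<le>
        (\<integral>\<^sup>+x. ennreal (exp t) * emeasure (M x) (Pair x -` S) + ennreal (\<delta> t) \<partial>P)"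
      unfolding j(2) using Ps by (intro nn_integral_mono out2 j t) auto
    also have "\<dots> = ennreal (exp t) * emeasure (joint_law X Y P M) S + ennreal (\<delta> t)"
      using j by (simp add: nn_integral_add nn_integral_cmult P.emeasure_space_1)
    finally show "emeasure (P \<Otimes>\<^sub>M (P \<bind> M)) S \<le>
        ennreal (exp t) * emeasure (joint_law X Y P M) S + ennreal (\<delta> t)" .
  qed (use dm d0 in auto)
  then show "channel_information X Y P M \<le> mu_CI \<delta>"
    by (simp add: channel_information_eq_kl_bits[OF P M])
qed

theorem theorem1:
  fixes X :: "'a measure"
  assumes two_points: "\<exists>x\<in>space X. \<exists>y\<in>space X. x \<noteq> y"
    and singletons: "\<forall>x\<in>space X. {x} \<in> sets X"
  shows
    "(\<forall>\<mu>::real. \<mu> \<ge> 0 \<longrightarrow>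
        (\<forall>\<epsilon>>0. delta_LDP \<mu> \<epsilon> \<in> delta_LDP_values \<mu> \<epsilon>) \<and>
        (\<forall>(Y :: 'b measure) M. mechanism X Y M \<longrightarrow>
           CI_LMIP X Y (distributions X) (ereal \<mu>) M \<longrightarrow>
           (\<forall>\<epsilon>>0. LDP X Y \<epsilon> (delta_LDP \<mu> \<epsilon>) M)) \<and>
        (\<forall>\<epsilon>>0. \<exists>(Y :: bool measure) M. mechanism X Y M \<and>
           CI_LMIP X Y (distributions X) (ereal \<mu>) M \<and>
           (\<forall>\<delta> < delta_LDP \<mu> \<epsilon>. \<not> LDP X Y \<epsilon> \<delta> M)))
     \<and> (\<forall>\<epsilon>\<^sub>0\<in>{0..1::real}. \<forall>\<epsilon>\<^sub>1\<in>{0..1::real}.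
        (\<epsilon>\<^sub>0 + \<epsilon>\<^sub>1 = 1 \<longrightarrow> C_BAC \<epsilon>\<^sub>0 \<epsilon>\<^sub>1 = 0) \<and>
        (\<epsilon>\<^sub>0 + \<epsilon>\<^sub>1 \<noteq> 1 \<longrightarrow>
           (\<epsilon>\<^sub>0 \<le> min \<epsilon>\<^sub>1 (min (1 - \<epsilon>\<^sub>1) (1 / 2)) \<longrightarrow>
              C_BAC \<epsilon>\<^sub>0 \<epsilon>\<^sub>1 =
                ereal (\<epsilon>\<^sub>0 / (1 - \<epsilon>\<^sub>0 - \<epsilon>\<^sub>1) * binary_entropy \<epsilon>\<^sub>1
                  - (1 - \<epsilon>\<^sub>1) / (1 - \<epsilon>\<^sub>0 - \<epsilon>\<^sub>1) * binary_entropy \<epsilon>\<^sub>0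
                  + log 2 (1 + 2 powr ((binary_entropy \<epsilon>\<^sub>0 - binary_entropy \<epsilon>\<^sub>1)
                                       / (1 - \<epsilon>\<^sub>0 - \<epsilon>\<^sub>1))))) \<and>
           (\<epsilon>\<^sub>0 > \<epsilon>\<^sub>1 \<longrightarrow> C_BAC \<epsilon>\<^sub>0 \<epsilon>\<^sub>1 = C_BAC \<epsilon>\<^sub>1 \<epsilon>\<^sub>0) \<and>
           (\<epsilon>\<^sub>0 > 1 - \<epsilon>\<^sub>1 \<longrightarrow> C_BAC \<epsilon>\<^sub>0 \<epsilon>\<^sub>1 = C_BAC (1 - \<epsilon>\<^sub>1) (1 - \<epsilon>\<^sub>0)) \<and>
           (\<epsilon>\<^sub>0 > 1 / 2 \<longrightarrow> C_BAC \<epsilon>\<^sub>0 \<epsilon>\<^sub>1 = C_BAC (1 - \<epsilon>\<^sub>0) (1 - \<epsilon>\<^sub>1))))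
     \<and> (\<forall>\<delta> :: real \<Rightarrow> real.
        \<delta> \<in> borel_measurable (restrict_space borel {0<..}) \<longrightarrow>
        (\<forall>\<epsilon>>0. \<delta> \<epsilon> \<in> {0..1}) \<longrightarrow>
        (\<forall>(Y :: 'b measure) M. mechanism X Y M \<longrightarrow>
           (\<forall>\<epsilon>>0. LDP X Y \<epsilon> (\<delta> \<epsilon>) M) \<longrightarrow>
           CI_LMIP X Y (distributions X) (mu_CI \<delta>) M))"
proof (intro conjI allI ballI impI)
  fix \<mu> \<epsilon> :: real
  assume mu: "\<mu> \<ge> 0" and eps: "\<epsilon> > 0"
  show "delta_LDP \<mu> \<epsilon> \<in> delta_LDP_values \<mu> \<epsilon>"
    using mu by (rule delta_LDP_in_values)
  show "LDP X Y \<epsilon> (delta_LDP \<mu> \<epsilon>) M"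
    if "mechanism X Y M" "CI_LMIP X Y (distributions X) (ereal \<mu>) M"
    for Y :: "'b measure" and M
    using singletons eps mu that by (rule CI_LMIP_imp_LDP)
  obtain x\<^sub>0 x\<^sub>1 where "x\<^sub>0 \<in> space X" "x\<^sub>1 \<in> space X" "x\<^sub>0 \<noteq> x\<^sub>1"
    using two_points by blast
  then show "\<exists>(Y :: bool measure) M. mechanism X Y M \<and>
      CI_LMIP X Y (distributions X) (ereal \<mu>) M \<and> (\<forall>\<delta> < delta_LDP \<mu> \<epsilon>. \<not> LDP X Y \<epsilon> \<delta> M)"
    using singletons mu by (intro LDP_tight[of x\<^sub>0 X x\<^sub>1]) auto
next
  fix \<epsilon>\<^sub>0 \<epsilon>\<^sub>1 :: real
  assume e: "\<epsilon>\<^sub>0 \<in> {0..1}" "\<epsilon>\<^sub>1 \<in> {0..1}"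
  show "C_BAC \<epsilon>\<^sub>0 \<epsilon>\<^sub>1 = 0" if "\<epsilon>\<^sub>0 + \<epsilon>\<^sub>1 = 1"
  proof -
    have "\<epsilon>\<^sub>1 = 1 - \<epsilon>\<^sub>0" using that by linarith
    then show ?thesis using C_BAC_zero[OF e(1)] by simp
  qed
  show "C_BAC \<epsilon>\<^sub>0 \<epsilon>\<^sub>1 =
      ereal (\<epsilon>\<^sub>0 / (1 - \<epsilon>\<^sub>0 - \<epsilon>\<^sub>1) * binary_entropy \<epsilon>\<^sub>1
        - (1 - \<epsilon>\<^sub>1) / (1 - \<epsilon>\<^sub>0 - \<epsilon>\<^sub>1) * binary_entropy \<epsilon>\<^sub>0
        + log 2 (1 + 2 powr ((binary_entropy \<epsilon>\<^sub>0 - binary_entropy \<epsilon>\<^sub>1) / (1 - \<epsilon>\<^sub>0 - \<epsilon>\<^sub>1))))"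
    if "\<epsilon>\<^sub>0 + \<epsilon>\<^sub>1 \<noteq> 1" "\<epsilon>\<^sub>0 \<le> min \<epsilon>\<^sub>1 (min (1 - \<epsilon>\<^sub>1) (1 / 2))"
    \<comment> \<open>The bound by \<open>1 - \<epsilon>\<^sub>1\<close> together with the excluded
      equality puts the sum strictly below 1.\<close>
    using that by (intro C_BAC_formula e) auto
  show "C_BAC \<epsilon>\<^sub>0 \<epsilon>\<^sub>1 = C_BAC \<epsilon>\<^sub>1 \<epsilon>\<^sub>0" "C_BAC \<epsilon>\<^sub>0 \<epsilon>\<^sub>1 = C_BAC (1 - \<epsilon>\<^sub>1) (1 - \<epsilon>\<^sub>0)"
    "C_BAC \<epsilon>\<^sub>0 \<epsilon>\<^sub>1 = C_BAC (1 - \<epsilon>\<^sub>0) (1 - \<epsilon>\<^sub>1)"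
    using C_BAC_symmetries[OF e] by simp_all
next
  fix \<delta> :: "real \<Rightarrow> real" and Y :: "'b measure" and M
  assume "\<delta> \<in> borel_measurable (restrict_space borel {0<..})" "\<forall>\<epsilon>>0. \<delta> \<epsilon> \<in> {0..1}"
    "mechanism X Y M" "\<forall>\<epsilon>>0. LDP X Y \<epsilon> (\<delta> \<epsilon>) M"
  then show "CI_LMIP X Y (distributions X) (mu_CI \<delta>) M"
    by (intro CI_LMIP_mu_CI) auto
qed

end
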